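(* For every positive integer $p$ there exists a constant $\epsilon_p>0$ such that the following holds. If $n$ and $\delta$ are positive integers with $(1-1/(p+1)-\epsilon_p)n<\delta\le(1-1/(p+1))n$ and $\delta=(1-\beta)n$, then $k_r(n,\delta)\ge g_r(\beta)n^r$ for every positive integer $r$. Moreover, for $3\le r\le p+1$, equality holds if and only if $(n,\beta)$ is feasible, and the graphs of order $n$ and minimum degree $\delta$ attaining equality are exactly the members of $\mathcal{G}(n,\beta)$.
   Context: All graphs are finite and simple; $k_r(G)$ is the number of $r$-cliques of $G$, and $k_r(n,\delta)$ is the minimum of $k_r(G)$ over all graphs $G$ of order $n$ with minimum degree $\delta$. Throughout, $\delta=(1-\beta)n$ with $0<\beta<1$, and $p=\lceil \beta^{-1}\rceil-1$, so $1/(p+1)\le \beta<1/p$. For such $\beta$ and integers $r$, define $$g_r(\beta)=\binom{p-1}{r}\beta^{r}+\binom{p-1}{r-1}(1-(p-1)\beta)\beta^{r-1}+\frac12\binom{p-1}{r-2}(1-p\beta)(1-(p-1)\beta)\beta^{r-2},$$ where $\binom{x}{y}=0$ if $x<y$ or $y<0$. The family $\mathcal{G}(n,\beta)$ (defined only when $n$ and $(1-\beta)n$ are positive integers not both odd) consists of all graphs $G$ on vertex set $V$, $|V|=n$, admitting a partition $V=V_0\cup V_1\cup\dots\cup V_{p-1}$ with $|V_0|=(1-(p-1)\beta)n$ and $|V_i|=\beta n$ for $1\le i\le p-1$, such that: all edges between $V_i$ and $V_j$ are present for $0\le i<j\le p-1$; $V_i$ is independent for $1\le i\le p-1$; and $G[V_0]$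 is $(1-p\beta)n$-regular with minimum number of triangles among all $(1-p\beta)n$-regular graphs on $|V_0|$ vertices. The pair $(n,\beta)$ is feasible if $\mathcal{G}(n,\beta)$ is defined and $G[V_0]$ is triangle-free for $G\in\mathcal{G}(n,\beta)$. *)

theory Defs
  imports Complex_Main
begin

definition graph :: "nat \<Rightarrow> (nat \<Rightarrow> nat \<Rightarrow> bool) \<Rightarrow> bool" where
  "graph n E \<longleftrightarrow> (\<forall>u v. E u v \<longrightarrow> E v u) \<and> (\<forall>v. \<not> E v v)
                  \<and> (\<forall>u v. E u v \<longrightarrow> u < n \<and> v < n)"

definition degree :: "nat set \<Rightarrow> (nat \<Rightarrow> nat \<Rightarrow> bool) \<Rightarrow> nat \<Rightarrow> nat" where
  "degree V E v = card {u \<in> V. E v u}"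

definition mindeg :: "nat \<Rightarrow> (nat \<Rightarrow> nat \<Rightarrow> bool) \<Rightarrow> nat" where
  "mindeg n E = Min ((degree {..<n} E) ` {..<n})"

definition cliques :: "nat set \<Rightarrow> (nat \<Rightarrow> nat \<Rightarrow> bool) \<Rightarrow> nat \<Rightarrow> nat set set" where
  "cliques V E r = {S. S \<subseteq> V \<and> card S = r \<and> (\<forall>x\<in>S. \<forall>y\<in>S. x \<noteq> y \<longrightarrow> E x y)}"

definition kr :: "nat \<Rightarrow> (nat \<Rightarrow> nat \<Rightarrow> bool) \<Rightarrow> nat \<Rightarrow> nat" where
  "kr n E r = card (cliques {..<n} E r)"

definition kmin :: "nat \<Rightarrow> nat \<Rightarrow> nat \<Rightarrow> nat" where
  "kmin n \<delta> r = Min {kr n E r | E. graph n E \<and> mindeg n E = \<delta>}"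

definition p_of :: "real \<Rightarrow> nat" where
  "p_of \<beta> = nat (\<lceil>1 / \<beta>\<rceil> - 1)"

definition cbinom :: "int \<Rightarrow> int \<Rightarrow> real" where
  "cbinom x y = (if y < 0 \<or> x < y then 0 else real (nat x choose nat y))"

definition g :: "nat \<Rightarrow> real \<Rightarrow> real" where
  "g r \<beta> = (let p = int (p_of \<beta>); r' = int r in
      cbinom (p - 1) r' * \<beta> powi r'
    + cbinom (p - 1) (r' - 1) * (1 - of_int (p - 1) * \<beta>) * \<beta> powi (r' - 1)
    + 1/2 * cbinom (p - 1) (r' - 2) * (1 - of_int p * \<beta>) * (1 - of_int (p - 1) * \<beta>)
        * \<beta> powi (r' - 2))"

definition regular_on :: "nat set \<Rightarrow> (nat \<Rightarrow> nat \<Rightarrow> bool) \<Rightarrow> real \<Rightarrow> bool" where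
  "regular_on V E d \<longleftrightarrow> (\<forall>v\<in>V. real (degree V E v) = d)"

definition family_defined :: "nat \<Rightarrow> real \<Rightarrow> bool" where
  "family_defined n \<beta> \<longleftrightarrow> 0 < n \<and> 0 < \<beta> \<and> \<beta> < 1 \<and>
     (\<exists>\<delta>::nat. 0 < \<delta> \<and> real \<delta> = (1 - \<beta>) * real n \<and> \<not> (odd n \<and> odd \<delta>))"

definition admissible :: "nat \<Rightarrow> real \<Rightarrow> (nat \<Rightarrow> nat \<Rightarrow> bool) \<Rightarrow> (nat \<Rightarrow> nat) \<Rightarrow> bool" where
  "admissible n \<beta> E part \<longleftrightarrow>
     (let p = p_of \<beta>; V = (\<lambda>i. {v. v < n \<and> part v = i}) in
        (\<forall>v<n. part v < p) \<and>
        real (card (V 0)) = (1 - real (p - 1) * \<beta>) * real n \<and>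
        (\<forall>i. 1 \<le> i \<and> i \<le> p - 1 \<longrightarrow> real (card (V i)) = \<beta> * real n) \<and>
        (\<forall>u v. u < n \<and> v < n \<and> part u \<noteq> part v \<longrightarrow> E u v) \<and>
        (\<forall>i. 1 \<le> i \<and> i \<le> p - 1 \<longrightarrow> (\<forall>u\<in>V i. \<forall>v\<in>V i. \<not> E u v)) \<and>
        regular_on (V 0) E ((1 - real p * \<beta>) * real n) \<and>
        (\<forall>H. graph (card (V 0)) H \<and> regular_on {..<card (V 0)} H ((1 - real p * \<beta>) * real n)
              \<longrightarrow> card (cliques (V 0) E 3) \<le> kr (card (V 0)) H 3))"

definition family :: "nat \<Rightarrow> real \<Rightarrow> (nat \<Rightarrow> nat \<Rightarrow> bool) set" where
  "family n \<beta> = {E. graph n E \<and> (\<exists>part. admissible n \<beta> E part)}"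

definition feasible :: "nat \<Rightarrow> real \<Rightarrow> bool" where
  "feasible n \<beta> \<longleftrightarrow> family_defined n \<beta> \<and>
     (\<forall>E\<in>family n \<beta>. \<forall>part. admissible n \<beta> E part \<longrightarrow>
        cliques {v. v < n \<and> part v = 0} E 3 = {})"

end

theory Submission
  imports Defs
begin

text \<open>
  For a clique \<open>S\<close> let \<open>D(S)\<close> be the proportion of vertices adjacent to all of \<open>S\<close>, and let
  \<open>x(S) = D(S) - (1 - |S|\<beta>)\<close> be its excess; put \<open>\<gamma> = (p+1)\<beta> - 1\<close>. The excess is nonnegative and
  monotone under inclusion, counting degrees gives \<open>(t-1) x(T) \<le> \<Sum>v\<in>T. x(T - {v})\<close> for every
  \<open>(t+1)\<close>-clique \<open>T\<close>, and \<open>x(T) \<ge> \<gamma>\<close> when \<open>|T| = p+1\<close>. In an extremal graph \<open>x(S)\<close> is \<open>\<gamma>\<close> or \<open>0\<close>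
  according to whether \<open>S\<close> contains an edge of \<open>V\<^sub>0\<close>. If all excesses were at most \<open>\<gamma>\<close>, double
  counting would give a system of linear inequalities between the clique counts and the total
  excesses, with solution \<open>g\<^sub>r(\<beta>)\<close>. Truncating the excesses at \<open>\<gamma>\<close> keeps this system up to an
  error \<open>\<gamma>\<close> times the total overshoot. A clique of size at most \<open>p+1\<close> with overshoot extends
  to many \<open>(p+2)\<close>-cliques, which contain edges with overshoot bounded below, so the total overshoot
  in each size is \<open>O(Z)\<close>, where \<open>Z\<close> is the total overshoot of the edges. As \<open>Z\<close> itself
  contributes to the clique counts without the factor \<open>\<gamma>\<close>, it absorbs the error once \<open>\<gamma>\<close> is small.
  Equality forces \<open>Z = 0\<close>, no \<open>(p+2)\<close>-clique, and excess \<open>0\<close> or \<open>\<gamma>\<close> for every \<open>p\<close>-clique; the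
  parts \<open>V\<^sub>i\<close> can then be read off from the neighbourhoods of a single \<open>(p+1)\<close>-clique.
\<close>

section \<open>Cliques and their excess\<close>

definition nbrs :: "nat \<Rightarrow> (nat \<Rightarrow> nat \<Rightarrow> bool) \<Rightarrow> nat set \<Rightarrow> nat set" where
  "nbrs n E S = {v. v < n \<and> (\<forall>u\<in>S. E u v)}"

lemma finite_nbrs [simp]: "finite (nbrs n E S)"
  by (rule finite_subset[of _ "{..<n}"]) (auto simp: nbrs_def)

lemma nbrs_empty [simp]: "nbrs n E {} = {..<n}"
  by (auto simp: nbrs_def)

lemma card_nbrs_singleton: "card (nbrs n E {v}) = degree {..<n} E v"
  unfolding nbrs_def degree_def by (rule arg_cong[of _ _ card]) auto

lemma card_nbrs_le: "card (nbrs n E S) \<le> n"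
  using card_mono[of "{..<n}" "nbrs n E S"] by (auto simp: nbrs_def)

lemma finite_cliques [simp]: "finite V \<Longrightarrow> finite (cliques V E r)"
  by (rule finite_subset[of _ "Pow V"]) (auto simp: cliques_def)

lemma cliquesD:
  assumes "S \<in> cliques {..<n} E r"
  shows "S \<subseteq> {..<n}" "finite S" "card S = r"
    and "\<And>u v. u \<in> S \<Longrightarrow> v \<in> S \<Longrightarrow> u \<noteq> v \<Longrightarrow> E u v"
  using assms finite_subset[of S "{..<n}"] by (auto simp: cliques_def)

lemma clique_remove:
  "T \<in> cliques {..<n} E (Suc t) \<Longrightarrow> v \<in> T \<Longrightarrow> T - {v} \<in> cliques {..<n} E t"
  using cliquesD(2)[of T n E "Suc t"] by (auto simp: cliques_def)

lemma clique_insert: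
  assumes "graph n E" "S \<in> cliques {..<n} E t" "v \<in> nbrs n E S"
  shows "insert v S \<in> cliques {..<n} E (Suc t)" "v \<notin> S"
proof -
  show v: "v \<notin> S"
    using assms by (auto simp: nbrs_def graph_def)
  show "insert v S \<in> cliques {..<n} E (Suc t)"
    using assms v cliquesD[OF assms(2)]
    by (auto simp: cliques_def nbrs_def graph_def card_insert_if)
qed

text \<open>The pairs of a clique \<open>T\<close> and a vertex \<open>v\<close> of it correspond to
  the pairs of a clique \<open>S = T - {v}\<close> and a common neighbour \<open>v\<close> of
  \<open>S\<close>.\<close>

lemma double_count:
  fixes f :: "nat set \<Rightarrow> real"
  assumes "graph n E"
  shows "(\<Sum>T\<in>cliques {..<n} E (Suc t). \<Sum>v\<in>T. f (T - {v}))
       = (\<Sum>S\<in>cliques {..<n} E t. real (card (nbrs n E S)) * f S)"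
proof -
  let ?K = "cliques {..<n} E"
  have "(\<Sum>T\<in>?K (Suc t). \<Sum>v\<in>T. f (T - {v})) = (\<Sum>(T,v)\<in>Sigma (?K (Suc t)) (\<lambda>T. T). f (T - {v}))"
    by (rule sum.Sigma) (auto dest: cliquesD)
  also have "\<dots> = (\<Sum>(S,v)\<in>Sigma (?K t) (nbrs n E). f S)"
  proof (rule sum.reindex_bij_witness[where i = "\<lambda>(S,v). (insert v S, v)" and j = "\<lambda>(T,v). (T - {v}, v)"])
    fix a assume "a \<in> Sigma (?K t) (nbrs n E)"
    then show "(case a of (S, v) \<Rightarrow> (insert v S, v)) \<in> Sigma (?K (Suc t)) (\<lambda>T. T)"
      "(case (case a of (S, v) \<Rightarrow> (insert v S, v)) of (T, v) \<Rightarrow> (T - {v}, v)) = a"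
      using clique_insert[OF assms] by auto
  next
    fix a assume a: "a \<in> Sigma (?K (Suc t)) (\<lambda>T. T)"
    then show "(case (case a of (T, v) \<Rightarrow> (T - {v}, v)) of (S, v) \<Rightarrow> (insert v S, v)) = a"
      by auto
    show "(case a of (T, v) \<Rightarrow> (T - {v}, v)) \<in> Sigma (?K t) (nbrs n E)"
      using a clique_remove cliquesD(1,4) by (fastforce simp: nbrs_def)
  qed auto
  also have "\<dots> = (\<Sum>S\<in>?K t. \<Sum>v\<in>nbrs n E S. f S)"
    by (rule sum.Sigma[symmetric]) auto
  also have "\<dots> = (\<Sum>S\<in>?K t. real (card (nbrs n E S)) * f S)"
    by simp
  finally show ?thesis .
qed

lemma kr_Suc:
  assumes "graph n E"
  shows "real (Suc t) * real (kr n E (Suc t)) = (\<Sum>S\<in>cliques {..<n} E t. real (card (nbrs n E S)))"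
proof -
  have "(\<Sum>T\<in>cliques {..<n} E (Suc t). \<Sum>v\<in>T. (1::real)) = (\<Sum>T\<in>cliques {..<n} E (Suc t). real (Suc t))"
    by (rule sum.cong) (auto dest: cliquesD)
  then show ?thesis
    using double_count[OF assms, of "\<lambda>_. 1" t] by (simp add: kr_def mult.commute)
qed

lemma cliques_1: "cliques {..<n} E 1 = (\<lambda>v. {v}) ` {..<n}"
  by (auto simp: cliques_def card_1_singleton_iff)

lemma kr_1: "kr n E 1 = n"
  unfolding kr_def cliques_1 by (simp add: card_image)

text \<open>\<open>1 - card S * \<beta>\<close> is the density that remains when each vertex of
  \<open>S\<close> excludes \<open>\<beta> * n\<close> non-neighbours and these sets are
  disjoint.\<close>

definition exc :: "nat \<Rightarrow> (nat \<Rightarrow> nat \<Rightarrow> bool) \<Rightarrow> real \<Rightarrow> nat set \<Rightarrow> real" where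
  "exc n E \<beta> S = real (card (nbrs n E S)) / real n - 1 + real (card S) * \<beta>"

locale min_degree_graph =
  fixes n :: nat and E :: "nat \<Rightarrow> nat \<Rightarrow> bool" and \<beta> :: real
  assumes graph: "graph n E" and n_pos: "0 < n"
    and deg_ge: "\<And>v. v < n \<Longrightarrow> (1 - \<beta>) * real n \<le> real (degree {..<n} E v)"
begin

abbreviation "K t \<equiv> cliques {..<n} E t"
abbreviation "x \<equiv> exc n E \<beta>"

lemma card_nbrs_eq: "card S = t \<Longrightarrow> real (card (nbrs n E S)) = real n * (1 - real t * \<beta> + x S)"
  using n_pos by (simp add: exc_def field_simps)

lemma card_nbrs_insert_ge:
  assumes "v < n"
  shows "real (card (nbrs n E (insert v S))) \<ge> real (card (nbrs n E S)) - \<beta> * real n"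
proof -
  have eq: "nbrs n E (insert v S) = nbrs n E S \<inter> nbrs n E {v}"
    by (auto simp: nbrs_def)
  have "card (nbrs n E S \<union> nbrs n E {v}) \<le> card {..<n}"
    by (rule card_mono) (auto simp: nbrs_def)
  moreover have "card (nbrs n E S) + card (nbrs n E {v})
      = card (nbrs n E S \<union> nbrs n E {v}) + card (nbrs n E (insert v S))"
    unfolding eq by (rule card_Un_Int) auto
  ultimately have "card (nbrs n E S) + degree {..<n} E v \<le> n + card (nbrs n E (insert v S))"
    by (simp add: card_nbrs_singleton)
  then have "real (card (nbrs n E S)) + real (degree {..<n} E v) \<le> real n + real (card (nbrs n E (insert v S)))"
    by linarith
  then show ?thesis
    using deg_ge[OF assms] by (simp add: algebra_simps)
qed

text \<open>Adding a vertex costs at most \<open>\<beta> * n\<close> common neighbours, while the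
  baseline \<open>1 - card S * \<beta>\<close> drops by exactly \<open>\<beta>\<close>.\<close>

lemma exc_mono:
  assumes "T \<subseteq> {..<n}" "v \<in> T"
  shows "x (T - {v}) \<le> x T"
proof -
  have fin: "finite T" using assms finite_subset by blast
  have "insert v (T - {v}) = T" using assms by auto
  then have *: "real (card (nbrs n E T)) \<ge> real (card (nbrs n E (T - {v}))) - \<beta> * real n"
    using card_nbrs_insert_ge[of v "T - {v}"] assms by auto
  have c: "real (card T) = real (card (T - {v})) + 1"
    using assms fin card_Suc_Diff1[of T v] by linarith
  have "real (card (nbrs n E (T - {v}))) / real n \<le> real (card (nbrs n E T)) / real n + \<beta>"
    using * n_pos by (simp add: field_simps)
  then show ?thesis
    unfolding exc_def c by (simp add: algebra_simps)
qed

lemma exc_nonneg: "T \<subseteq> {..<n} \<Longrightarrow> 0 \<le> x T"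
proof (induction "card T" arbitrary: T)
  case 0
  then have "T = {}" using finite_subset[of T "{..<n}"] by auto
  then show ?case using n_pos by (simp add: exc_def)
next
  case (Suc t)
  then obtain v where v: "v \<in> T" by fastforce
  have "card (T - {v}) = t"
    using Suc v by (metis card_Diff_singleton diff_Suc_1)
  then have "0 \<le> x (T - {v})"
    using Suc(1)[of "T - {v}"] Suc(3) by auto
  then show ?case
    using exc_mono[OF Suc(3) v] by simp
qed

text \<open>Each vertex \<open>w\<close> is weighed by the number \<open>?i w\<close> of its
  neighbours in \<open>T\<close> and by the number \<open>?j w\<close> of vertices \<open>u\<close>
  such that \<open>w\<close> is joined to all of \<open>T - {u}\<close>. A pointwise inequality is
  summed over \<open>w\<close>; the sum of \<open>?i\<close> is a degree sum, bounded below by the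
  minimum degree.\<close>

lemma exc_sum_ge:
  assumes T: "T \<in> K (Suc t)"
  shows "(real t - 1) * x T \<le> (\<Sum>v\<in>T. x (T - {v}))"
proof -
  note TD = cliquesD[OF T]
  let ?i = "\<lambda>w. card {u\<in>T. E u w}"
  let ?j = "\<lambda>w. card {u\<in>T. w \<in> nbrs n E (T - {u})}"
  let ?a = "\<lambda>w. if w \<in> nbrs n E T then 1 else (0::real)"
  have swap: "(\<Sum>w<n. real (card {u\<in>T. P u w})) = (\<Sum>u\<in>T. real (card {w. w < n \<and> P u w}))" for P
  proof -
    have "(\<Sum>w<n. real (card {u\<in>T. P u w})) = (\<Sum>w<n. \<Sum>u\<in>T. if P u w then 1 else 0)"
      using TD(2) by (intro sum.cong refl) (simp add: sum.If_cases Int_def)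
    also have "\<dots> = (\<Sum>u\<in>T. \<Sum>w<n. if P u w then 1 else 0)"
      by (rule sum.swap)
    also have "\<dots> = (\<Sum>u\<in>T. real (card {w. w < n \<and> P u w}))"
      by (intro sum.cong refl) (simp add: sum.If_cases Int_def)
    finally show ?thesis .
  qed
  have i: "(\<Sum>w<n. real (?i w)) = (\<Sum>u\<in>T. real (degree {..<n} E u))"
    unfolding swap degree_def by simp
  have j: "(\<Sum>w<n. real (?j w)) = (\<Sum>u\<in>T. real (card (nbrs n E (T - {u}))))"
    unfolding swap by (intro sum.cong refl arg_cong[of _ _ real] arg_cong[of _ _ card]) (auto simp: nbrs_def)
  have a: "(\<Sum>w<n. ?a w) = real (card (nbrs n E T))"
  proof -
    have "{..<n} \<inter> {w. w \<in> nbrs n E T} = nbrs n E T" by (auto simp: nbrs_def)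
    then show ?thesis by (simp add: sum.If_cases)
  qed
  \<comment> \<open>Equality holds when \<open>w\<close> is joined to all of \<open>T\<close> (both
    sides are \<open>t + 1\<close>) or to all but one vertex (both sides are 1). If \<open>w\<close>
    misses two or more vertices, the left side is at most 0.\<close>
  have pt: "real (?i w) - (real t - 1) + (real t - 1) * ?a w \<le> real (?j w)" if w: "w < n" for w
  proof (cases "w \<in> nbrs n E T")
    case True
    then have "{u\<in>T. E u w} = T" "{u\<in>T. w \<in> nbrs n E (T - {u})} = T"
      by (auto simp: nbrs_def)
    then show ?thesis using True TD(3) by simp
  next
    case False
    then obtain u where u: "u \<in> T" "\<not> E u w" using w by (auto simp: nbrs_def)
    have sub: "{u\<in>T. E u w} \<subseteq> T - {u}" using u by auto
    have cu: "card (T - {u}) = t" using TD u by simp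
    have le: "?i w \<le> t" using card_mono[OF _ sub] TD(2) cu by simp
    show ?thesis
    proof (cases "?i w = t")
      case True
      then have "{u\<in>T. E u w} = T - {u}"
        using card_subset_eq[OF _ sub] TD(2) cu by simp
      then have "u \<in> {u\<in>T. w \<in> nbrs n E (T - {u})}" using u w by (auto simp: nbrs_def)
      then have "?j w \<noteq> 0" using TD(2) by auto
      then have "1 \<le> real (?j w)" by linarith
      then show ?thesis using True False by simp
    next
      case neq: False
      then have "real (?i w) \<le> real t - 1" using le by linarith
      then show ?thesis using False by simp
    qed
  qed
  have "(\<Sum>w<n. real (?i w) - (real t - 1) + (real t - 1) * ?a w) \<le> (\<Sum>w<n. real (?j w))"
    by (rule sum_mono) (use pt in auto)
  then have 1: "(\<Sum>u\<in>T. real (degree {..<n} E u)) - real n * (real t - 1)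
      + (real t - 1) * real (card (nbrs n E T)) \<le> (\<Sum>u\<in>T. real (card (nbrs n E (T - {u}))))"
    by (simp only: sum.distrib sum_subtractf sum_distrib_left[symmetric] i j a) (simp add: algebra_simps)
  have "(\<Sum>u\<in>T. (1 - \<beta>) * real n) \<le> (\<Sum>u\<in>T. real (degree {..<n} E u))"
    by (rule sum_mono) (use TD(1) deg_ge in auto)
  then have 2: "real (Suc t) * ((1 - \<beta>) * real n) \<le> (\<Sum>u\<in>T. real (degree {..<n} E u))"
    using TD(3) by simp
  have 3: "(\<Sum>u\<in>T. real (card (nbrs n E (T - {u}))))
      = real n * (real (Suc t) * (1 - real t * \<beta>) + (\<Sum>u\<in>T. x (T - {u})))"
  proof -
    have "(\<Sum>u\<in>T. real (card (nbrs n E (T - {u})))) = (\<Sum>u\<in>T. real n * (1 - real t * \<beta> + x (T - {u})))"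
      by (intro sum.cong refl card_nbrs_eq) (use TD in simp)
    then show ?thesis using TD(3) by (simp add: sum_distrib_left[symmetric] sum.distrib)
  qed
  have "real n * ((real t - 1) * x T) \<le> real n * (\<Sum>u\<in>T. x (T - {u}))"
    using 1 2 unfolding 3 card_nbrs_eq[OF TD(3)] by (simp add: algebra_simps)
  then show ?thesis using n_pos by simp
qed

end

section \<open>Total excess, truncation and overshoot\<close>

context min_degree_graph
begin

text \<open>The sum over the \<open>t\<close>-cliques is divided by \<open>n ^ t\<close> and not by
  their number: in this scaling \<open>n\<close> drops out of the recursions, and \<open>avg\<close>
  of the constant 1 is the normalised clique count \<open>\<kappa>\<close>.\<close>

definition avg :: "(nat set \<Rightarrow> real) \<Rightarrow> nat \<Rightarrow> real" where
  "avg f t = (\<Sum>S\<in>K t. f S) / real n ^ t"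

text \<open>This is \<open>double_count\<close> rescaled: \<open>1 - t * \<beta> + x S\<close> is
  the density of the common neighbourhood of \<open>S\<close>.\<close>

lemma avg_shift:
  "avg (\<lambda>T. \<Sum>v\<in>T. f (T - {v})) (Suc t) = avg (\<lambda>S. (1 - real t * \<beta> + x S) * f S) t"
proof -
  have "(\<Sum>S\<in>K t. real (card (nbrs n E S)) * f S) = (\<Sum>S\<in>K t. real n * ((1 - real t * \<beta> + x S) * f S))"
    by (intro sum.cong refl) (simp add: card_nbrs_eq cliquesD(3))
  then show ?thesis
    using n_pos by (simp add: avg_def double_count[OF graph] sum_distrib_left[symmetric])
qed

lemma avg_mono: "(\<And>S. S \<in> K t \<Longrightarrow> f S \<le> h S) \<Longrightarrow> avg f t \<le> avg h t"
  unfolding avg_def by (intro divide_right_mono sum_mono) auto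

lemma avg_nonneg: "(\<And>S. S \<in> K t \<Longrightarrow> 0 \<le> f S) \<Longrightarrow> 0 \<le> avg f t"
  unfolding avg_def by (intro divide_nonneg_nonneg sum_nonneg) auto

lemma avg_cong: "(\<And>S. S \<in> K t \<Longrightarrow> f S = h S) \<Longrightarrow> avg f t = avg h t"
  unfolding avg_def by (intro arg_cong2[of _ _ _ _ "(/)"] sum.cong) auto

lemma avg_add: "avg (\<lambda>S. f S + h S) t = avg f t + avg h t"
  by (simp add: avg_def sum.distrib add_divide_distrib)

lemma avg_diff: "avg (\<lambda>S. f S - h S) t = avg f t - avg h t"
  by (simp add: avg_def sum_subtractf diff_divide_distrib)

lemma avg_cmult: "avg (\<lambda>S. c * f S) t = c * avg f t"
  by (simp add: avg_def sum_distrib_left[symmetric])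

lemma avg_eq_0D:
  assumes "avg f t = 0" "\<And>S. S \<in> K t \<Longrightarrow> 0 \<le> f S" "S \<in> K t"
  shows "f S = 0"
proof -
  have "(\<Sum>S\<in>K t. f S) = 0" using assms(1) n_pos by (simp add: avg_def)
  then show ?thesis using sum_nonneg_eq_0_iff[of "K t" f] assms by simp
qed

abbreviation "\<kappa> \<equiv> avg (\<lambda>_. 1)"

abbreviation "trunc a S \<equiv> min (x S) a"
abbreviation "over a S \<equiv> max (x S - a) 0"

lemma kappa_eq: "\<kappa> t = real (kr n E t) / real n ^ t"
  by (simp add: avg_def kr_def)

lemma kappa_1: "\<kappa> 1 = 1"
  unfolding kappa_eq kr_1 using n_pos by simp

lemma exc_nonneg': "S \<in> K t \<Longrightarrow> 0 \<le> x S"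
  by (rule exc_nonneg[OF cliquesD(1)])

lemma exc_mono': "T \<in> K t \<Longrightarrow> v \<in> T \<Longrightarrow> x (T - {v}) \<le> x T"
  by (rule exc_mono[OF cliquesD(1)])

lemma avg_exc_nonneg: "0 \<le> avg x t"
  by (rule avg_nonneg) (rule exc_nonneg')

lemma avg_over_nonneg: "0 \<le> avg (over a) t"
  by (rule avg_nonneg) simp

text \<open>This is \<open>avg_shift\<close> for the constant 1, whose sum over \<open>v\<close> in
  \<open>T\<close> is \<open>t + 1\<close>.\<close>

lemma kappa_Suc: "real (Suc t) * \<kappa> (Suc t) = (1 - real t * \<beta>) * \<kappa> t + avg x t"
proof -
  have "real (Suc t) * \<kappa> (Suc t) = avg (\<lambda>T. real (Suc t) * 1) (Suc t)"
    by (rule avg_cmult[symmetric])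
  also have "\<dots> = avg (\<lambda>T. \<Sum>v\<in>T. 1) (Suc t)"
    by (intro avg_cong) (simp add: cliquesD(3))
  also have "\<dots> = avg (\<lambda>S. (1 - real t * \<beta>) * 1 + x S) t"
    by (subst avg_shift) (simp add: algebra_simps)
  finally show ?thesis by (simp only: avg_add avg_cmult)
qed

lemma avg_exc_split: "avg x t = avg (trunc a) t + avg (over a) t"
  unfolding avg_add[symmetric] by (intro avg_cong) auto

text \<open>By monotonicity of \<open>x\<close>: truncation at \<open>a\<close> is concave and vanishes at 0.\<close>
lemma trunc_sum_ge:
  assumes T: "T \<in> K (Suc t)" and "0 \<le> a"
  shows "(real t - 1) * trunc a T \<le> (\<Sum>v\<in>T. trunc a (T - {v}))"
proof (cases "x T = 0")
  case True
  then have "0 \<le> (\<Sum>v\<in>T. trunc a (T - {v}))"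
    using assms(2) exc_nonneg'[OF clique_remove[OF T]] by (intro sum_nonneg) simp
  then show ?thesis using True assms(2) by simp
next
  case False
  then have pos: "0 < x T" using exc_nonneg'[OF T] by simp
  \<comment> \<open>Concavity in the form
    \<open>trunc a T / x T \<le> trunc a (T - {v}) / x (T - {v})\<close>, with denominators cleared
    because \<open>x (T - {v})\<close> may vanish.\<close>
  have conc: "trunc a T * x (T - {v}) \<le> trunc a (T - {v}) * x T" if "v \<in> T" for v
  proof -
    have b: "0 \<le> x (T - {v})" "x (T - {v}) \<le> x T"
      using exc_nonneg'[OF clique_remove[OF T that]] exc_mono'[OF T that] by auto
    show ?thesis
    proof (cases "x (T - {v}) \<le> a")
      case True
      then have "trunc a (T - {v}) = x (T - {v})" by simp
      moreover have "trunc a T * x (T - {v}) \<le> x T * x (T - {v})"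
        using b by (intro mult_right_mono) auto
      ultimately show ?thesis by (simp add: mult.commute)
    next
      case False
      then have "trunc a (T - {v}) = a" "trunc a T = a" using b by auto
      then show ?thesis using b assms(2) by (simp add: mult_left_mono)
    qed
  qed
  have "trunc a T * ((real t - 1) * x T) \<le> trunc a T * (\<Sum>v\<in>T. x (T - {v}))"
    using exc_sum_ge[OF T] assms pos by (intro mult_left_mono) auto
  also have "\<dots> \<le> (\<Sum>v\<in>T. trunc a (T - {v})) * x T"
    unfolding sum_distrib_left sum_distrib_right by (intro sum_mono conc)
  finally have "((real t - 1) * trunc a T) * x T \<le> (\<Sum>v\<in>T. trunc a (T - {v})) * x T"
    by (simp add: mult_ac)
  then show ?thesis using pos by simp
qed

text \<open>Write \<open>x = y + z\<close> with truncated part \<open>y\<close> and overshoot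
  \<open>z\<close>. Then \<open>x * y\<close> equals \<open>a * y - y * (a - y) + z * y\<close>, and
  \<open>z * y \<le> a * z\<close>. The gap \<open>y * (a - y)\<close> vanishes only for
  \<open>y = 0\<close> or \<open>y = a\<close>; it is kept for the equality case.\<close>

lemma avg_trunc_Suc:
  assumes "0 \<le> a"
  shows "(real t - 1) * avg (trunc a) (Suc t) + avg (\<lambda>S. trunc a S * (a - trunc a S)) t
    \<le> (1 - real t * \<beta> + a) * avg (trunc a) t + a * avg (over a) t"
proof -
  have "(real t - 1) * avg (trunc a) (Suc t) = avg (\<lambda>T. (real t - 1) * trunc a T) (Suc t)"
    by (rule avg_cmult[symmetric])
  also have "\<dots> \<le> avg (\<lambda>T. \<Sum>v\<in>T. trunc a (T - {v})) (Suc t)"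
    by (intro avg_mono trunc_sum_ge assms)
  also have "\<dots> = avg (\<lambda>S. (1 - real t * \<beta> + x S) * trunc a S) t"
    by (rule avg_shift)
  also have "\<dots> \<le> avg (\<lambda>S. (1 - real t * \<beta> + a) * trunc a S + a * over a S - trunc a S * (a - trunc a S)) t"
  proof (rule avg_mono)
    fix S assume S: "S \<in> K t"
    have "(c + (y + z)) * y \<le> (c + a) * y + a * z - y * (a - y)" if "z * y \<le> z * a" for c y z :: real
      using that by (simp add: algebra_simps)
    from this[of "over a S" "trunc a S" "1 - real t * \<beta>"]
    have "(1 - real t * \<beta> + (trunc a S + over a S)) * trunc a S
        \<le> (1 - real t * \<beta> + a) * trunc a S + a * over a S - trunc a S * (a - trunc a S)"
      by (simp add: mult_left_mono)
    moreover have "trunc a S + over a S = x S" by auto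
    ultimately show "(1 - real t * \<beta> + x S) * trunc a S
        \<le> (1 - real t * \<beta> + a) * trunc a S + a * over a S - trunc a S * (a - trunc a S)"
      by (simp only:)
  qed
  also have "\<dots> = (1 - real t * \<beta> + a) * avg (trunc a) t + a * avg (over a) t
      - avg (\<lambda>S. trunc a S * (a - trunc a S)) t"
    by (simp only: avg_add avg_diff avg_cmult)
  finally show ?thesis by simp
qed

section \<open>Passing overshoot between cliques of consecutive sizes\<close>

lemma density_le_1: "S \<in> K t \<Longrightarrow> 1 - real t * \<beta> + x S \<le> 1"
  using cliquesD(3)[of S n E t] card_nbrs_le[of n E S] n_pos by (simp add: exc_def)

text \<open>\<open>exc_sum_ge\<close> bounds \<open>x T\<close> by the excesses of the
  \<open>t + 1\<close> cliques \<open>T - {v}\<close>, each at most \<open>a\<close> plus its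
  overshoot. The factor 3 is the largest value of \<open>(t + 1) / (t - 1)\<close> for
  \<open>t \<ge> 2\<close>. The density factor from \<open>avg_shift\<close> is at most 1.\<close>

lemma avg_over_Suc_le:
  assumes "2 \<le> t" "0 \<le> a"
  shows "avg (over (3 * a)) (Suc t) \<le> avg (over a) t"
proof -
  have "avg (over (3 * a)) (Suc t) \<le> avg (\<lambda>T. \<Sum>v\<in>T. over a (T - {v})) (Suc t)"
  proof (rule avg_mono)
    fix T assume T: "T \<in> K (Suc t)"
    have nn: "0 \<le> (\<Sum>v\<in>T. over a (T - {v}))" by (intro sum_nonneg) auto
    have "(\<Sum>v\<in>T. x (T - {v}) - a) \<le> (\<Sum>v\<in>T. over a (T - {v}))" by (intro sum_mono) auto
    then have "(\<Sum>v\<in>T. x (T - {v})) - real (Suc t) * a \<le> (\<Sum>v\<in>T. over a (T - {v}))"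
      using cliquesD(3)[OF T] by (simp add: sum_subtractf)
    then have 1: "(real t - 1) * x T - real (Suc t) * a \<le> (\<Sum>v\<in>T. over a (T - {v}))"
      using exc_sum_ge[OF T] by linarith
    have "1 * (x T - 3 * a) \<le> (real t - 1) * (x T - 3 * a)" if "0 \<le> x T - 3 * a"
      using that assms by (intro mult_right_mono) auto
    moreover have "real (Suc t) * a \<le> 3 * (real t - 1) * a"
      using assms by (intro mult_right_mono) auto
    ultimately have "x T - 3 * a \<le> (\<Sum>v\<in>T. over a (T - {v}))" if "0 \<le> x T - 3 * a"
      using 1 that by (simp add: algebra_simps)
    then show "over (3 * a) T \<le> (\<Sum>v\<in>T. over a (T - {v}))" using nn by (cases "0 \<le> x T - 3 * a") auto
  qed
  also have "\<dots> = avg (\<lambda>S. (1 - real t * \<beta> + x S) * over a S) t"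
    by (rule avg_shift)
  also have "\<dots> \<le> avg (over a) t"
  proof (rule avg_mono)
    fix S assume S: "S \<in> K t"
    show "(1 - real t * \<beta> + x S) * over a S \<le> over a S"
      using mult_right_mono[OF density_le_1[OF S], of "over a S"] by simp
  qed
  finally show ?thesis .
qed

text \<open>Overshoot survives the extension of a clique, by monotonicity of \<open>x\<close>, and
  at least a proportion \<open>c\<close> of the vertices extends any given
  \<open>t\<close>-clique.\<close>

lemma avg_over_le_Suc:
  assumes c: "c \<le> 1 - real t * \<beta>" "0 \<le> c"
  shows "c * avg (over a) t \<le> real (Suc t) * avg (over a) (Suc t)"
proof -
  have "c * avg (over a) t = avg (\<lambda>S. c * over a S) t"
    by (rule avg_cmult[symmetric])
  also have "\<dots> \<le> avg (\<lambda>S. (1 - real t * \<beta> + x S) * over a S) t"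
  proof (intro avg_mono mult_right_mono)
    show "c \<le> 1 - real t * \<beta> + x S" if "S \<in> K t" for S
      using c exc_nonneg'[OF that] by linarith
  qed simp
  also have "\<dots> = avg (\<lambda>T. \<Sum>v\<in>T. over a (T - {v})) (Suc t)"
    by (rule avg_shift[symmetric])
  also have "\<dots> \<le> avg (\<lambda>T. real (Suc t) * over a T) (Suc t)"
  proof (rule avg_mono)
    fix T assume T: "T \<in> K (Suc t)"
    have "(\<Sum>v\<in>T. over a (T - {v})) \<le> (\<Sum>v\<in>T. over a T)"
      using exc_mono'[OF T] by (intro sum_mono max.mono) auto
    then show "(\<Sum>v\<in>T. over a (T - {v})) \<le> real (Suc t) * over a T"
      using cliquesD(3)[OF T] by simp
  qed
  also have "\<dots> = real (Suc t) * avg (over a) (Suc t)"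
    by (rule avg_cmult)
  finally show ?thesis .
qed

text \<open>Iterated descent from size \<open>k + 2\<close> to edges: high overshoot of large
  cliques is paid for by overshoot of edges.\<close>

lemma avg_over_2_ge: "0 \<le> a \<Longrightarrow> avg (over (3 ^ k * a)) (k + 2) \<le> avg (over a) 2"
proof (induction k)
  case (Suc k)
  then show ?case
    using avg_over_Suc_le[of "k + 2" "3 ^ k * a"] by (simp add: mult_ac)
qed (simp add: numeral_2_eq_2)

lemma exc_ge: "S \<in> K t \<Longrightarrow> real t * \<beta> - 1 \<le> x S"
  using cliquesD(3)[of S n E t] by (simp add: exc_def)

end

section \<open>The linear recursion behind g\<close>

text \<open>
  In a member of the family, \<open>g_edge p \<beta> t\<close> is the normalised number of the \<open>t\<close>-cliques that
  contain an edge of \<open>V\<^sub>0\<close>, the only ones with a nonzero excess.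
\<close>
definition g_edge :: "nat \<Rightarrow> real \<Rightarrow> nat \<Rightarrow> real" where
  "g_edge p \<beta> t = (if t < 2 then 0 else
     real ((p - 1) choose (t - 2)) * \<beta> ^ (t - 2) * ((1 - real p * \<beta>) * (1 - real (p - 1) * \<beta>) / 2))"

text \<open>The three summands count the cliques with zero, one and two vertices in
  \<open>V\<^sub>0\<close>. The test \<open>t = 0\<close> guards against the truncated subtraction
  in \<open>t - 1\<close>.\<close>

definition g_of :: "nat \<Rightarrow> real \<Rightarrow> nat \<Rightarrow> real" where
  "g_of p \<beta> t = real ((p - 1) choose t) * \<beta> ^ t
     + (if t = 0 then 0 else real ((p - 1) choose (t - 1)) * (1 - real (p - 1) * \<beta>) * \<beta> ^ (t - 1))
     + g_edge p \<beta> t"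

lemma g_eq_g_of:
  assumes "1 \<le> p" "p_of \<beta> = p" "1 \<le> r"
  shows "g r \<beta> = g_of p \<beta> r"
proof -
  have cb: "cbinom (int p - 1) (int r - int k) = real ((p - 1) choose (r - k))" if "k \<le> r" for k
  proof -
    have "int p - 1 = int (p - 1)" "int r - int k = int (r - k)" using that assms by auto
    then have "cbinom (int p - 1) (int r - int k) = cbinom (int (p - 1)) (int (r - k))" by (simp only:)
    also have "\<dots> = real ((p - 1) choose (r - k))"
      unfolding cbinom_def nat_int of_nat_less_iff
      by (cases "p - 1 < r - k") (simp_all add: binomial_eq_0)
    finally show ?thesis .
  qed
  have pw: "\<beta> powi (int r - int k) = \<beta> ^ (r - k)" if "k \<le> r" for k
  proof -
    have "int r - int k = int (r - k)" using that by auto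
    then show ?thesis by (simp only: power_int_of_nat)
  qed
  have p1: "real_of_int (int p - 1) = real (p - 1)" using assms by simp
  have e0: "cbinom (int p - 1) (int r) = real ((p - 1) choose r)" "\<beta> powi (int r) = \<beta> ^ r"
    using cb[of 0] pw[of 0] by simp_all
  have e1: "cbinom (int p - 1) (int r - 1) = real ((p - 1) choose (r - 1))" "\<beta> powi (int r - 1) = \<beta> ^ (r - 1)"
    using cb[of 1] pw[of 1] assms by simp_all
  show ?thesis
  proof (cases "r = 1")
    case True
    then show ?thesis using e1 p1 assms
      by (simp add: g_def Let_def g_of_def g_edge_def) (simp add: cbinom_def)
  next
    case False
    then have r2: "2 \<le> r" using assms by simp
    have e2: "cbinom (int p - 1) (int r - 2) = real ((p - 1) choose (r - 2))" "\<beta> powi (int r - 2) = \<beta> ^ (r - 2)"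
      using cb[of 2] pw[of 2] r2 by simp_all
    show ?thesis
      using r2 assms
      by (simp only: g_def Let_def g_of_def g_edge_def e0 e1 e2 p1 assms(2)) simp
  qed
qed

lemma binomial_Suc_real: "real (Suc k) * real (q choose Suc k) = (real q - real k) * real (q choose k)"
proof (cases "k \<le> q")
  case True
  have "Suc k * (q choose Suc k) = (q - k) * (q choose k)"
  proof (cases q)
    case (Suc q')
    then show ?thesis
      using Suc_times_binomial_eq[of q' k] binomial_absorb_comp[of q k] by (simp add: mult.commute)
  qed simp
  then have "real (Suc k * (q choose Suc k)) = real ((q - k) * (q choose k))" by (simp only:)
  then show ?thesis using True by (simp only: of_nat_mult of_nat_diff)
qed (simp add: binomial_eq_0)

text \<open>The recursion for truncated excesses with equality throughout, where
  \<open>1 - t * \<beta> + \<gamma> = (p + 1 - t) * \<beta>\<close>.\<close>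

lemma g_edge_Suc:
  assumes "2 \<le> t" "1 \<le> p"
  shows "(real t - 1) * g_edge p \<beta> (Suc t) = (real p + 1 - real t) * \<beta> * g_edge p \<beta> t"
proof -
  obtain k where t: "t = k + 2" using assms(1) by (metis add.commute le_Suc_ex)
  obtain q where p: "p = Suc q" using assms(2) by (metis One_nat_def Suc_le_D)
  define m where "m = (1 - real p * \<beta>) * (1 - real (p - 1) * \<beta>) / 2"
  have "(real t - 1) * g_edge p \<beta> (Suc t) = (real (Suc k) * real (q choose Suc k)) * (\<beta> ^ Suc k * m)"
    by (simp add: g_edge_def t p m_def)
  also have "\<dots> = (real p + 1 - real t) * \<beta> * (real (q choose k) * \<beta> ^ k * m)"
    unfolding binomial_Suc_real by (simp add: t p)
  also have "real (q choose k) * \<beta> ^ k * m = g_edge p \<beta> t"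
    by (simp add: g_edge_def t p m_def)
  finally show ?thesis .
qed

text \<open>The counterpart of \<open>kappa_Suc\<close> with total excess
  \<open>\<gamma> * g_edge p \<beta> t\<close>: each clique containing an edge of
  \<open>V\<^sub>0\<close> has excess \<open>\<gamma>\<close>.\<close>

lemma g_of_Suc:
  assumes "1 \<le> t" "1 \<le> p"
  shows "real (Suc t) * g_of p \<beta> (Suc t) = (1 - real t * \<beta>) * g_of p \<beta> t
    + ((real p + 1) * \<beta> - 1) * g_edge p \<beta> t"
proof -
  obtain q where p: "p = Suc q" using assms(2) by (metis One_nat_def Suc_le_D)
  obtain j where t: "t = Suc j" using assms(1) by (metis One_nat_def Suc_le_D)
  define s where "s = 1 - real q * \<beta>"
  have b1: "real (Suc (Suc j)) * real (q choose Suc (Suc j)) = (real q - real (Suc j)) * real (q choose Suc j)"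
    and b2: "real (Suc j) * real (q choose Suc j) = (real q - real j) * real (q choose j)"
    by (rule binomial_Suc_real)+
  show ?thesis
  proof (cases j)
    case 0
    have "real q * (real q - 1) = 2 * real (q choose 2)"
      using binomial_Suc_real[of 1 q] by (simp add: numeral_2_eq_2 algebra_simps)
    then show ?thesis
      by (simp add: g_of_def g_edge_def t p 0 numeral_2_eq_2 field_simps power2_eq_square) 
  next
    case (Suc k)
    have b3: "real (Suc k) * real (q choose Suc k) = (real q - real k) * real (q choose k)"
      by (rule binomial_Suc_real)
    define a b c d where "a = real (q choose Suc (Suc (Suc k)))" and "b = real (q choose Suc (Suc k))"
      and "c = real (q choose Suc k)" and "d = real (q choose k)"
    define w where "w = \<beta> ^ k"
    define K where "K = real k"
    define Q where "Q = real q"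
    have b1': "(K + 3) * a = (Q - K - 2) * b" and b2': "(K + 2) * b = (Q - K - 1) * c"
      and b3': "(K + 1) * c = (Q - K) * d"
      using b1 b2 b3 by (simp_all add: Suc a_def b_def c_def d_def K_def Q_def algebra_simps)
    have "(K + 3) * (a * (w * \<beta> * \<beta> * \<beta>) + b * (1 - Q * \<beta>) * (w * \<beta> * \<beta>)
          + c * (w * \<beta>) * ((1 - (Q + 1) * \<beta>) * (1 - Q * \<beta>) / 2))
        = (1 - (K + 2) * \<beta>) * (b * (w * \<beta> * \<beta>) + c * (1 - Q * \<beta>) * (w * \<beta>)
          + d * w * ((1 - (Q + 1) * \<beta>) * (1 - Q * \<beta>) / 2))
        + ((Q + 2) * \<beta> - 1) * (d * w * ((1 - (Q + 1) * \<beta>) * (1 - Q * \<beta>) / 2))"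
    proof -
      define h where "h = 1 - Q * \<beta>"
      define h' where "h' = (1 - (Q + 1) * \<beta>) * h / 2"
      \<comment> \<open>The difference of the two sides is an explicit combination of the three
        consecutive binomial identities.\<close>
      have "(K + 3) * (a * (w * \<beta> * \<beta> * \<beta>) + b * h * (w * \<beta> * \<beta>) + c * (w * \<beta>) * h')
          - (1 - (K + 2) * \<beta>) * (b * (w * \<beta> * \<beta>) + c * h * (w * \<beta>) + d * w * h')
          - ((Q + 2) * \<beta> - 1) * (d * w * h')
        = w * \<beta> * \<beta> * \<beta> * ((K + 3) * a - (Q - K - 2) * b)
          + w * \<beta> * \<beta> * h * ((K + 2) * b - (Q - K - 1) * c)
          + w * \<beta> * h' * ((K + 1) * c - (Q - K) * d)"
        unfolding h'_def h_def by (simp add: field_simps)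
      also have "\<dots> = 0" using b1' b2' b3' by simp
      finally show ?thesis unfolding h'_def h_def by simp
    qed
    moreover have "g_of p \<beta> (Suc t) = a * (w * \<beta> * \<beta> * \<beta>) + b * (1 - Q * \<beta>) * (w * \<beta> * \<beta>)
          + c * (w * \<beta>) * ((1 - (Q + 1) * \<beta>) * (1 - Q * \<beta>) / 2)"
      by (simp add: g_of_def g_edge_def t p Suc a_def b_def c_def w_def Q_def add_ac mult_ac)
    moreover have "g_edge p \<beta> t = d * w * ((1 - (Q + 1) * \<beta>) * (1 - Q * \<beta>) / 2)"
      by (simp add: g_edge_def t p Suc d_def w_def Q_def add_ac)
    moreover have "g_of p \<beta> t = b * (w * \<beta> * \<beta>) + c * (1 - Q * \<beta>) * (w * \<beta>) + g_edge p \<beta> t"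
      by (simp add: g_of_def t p Suc b_def c_def w_def Q_def mult_ac)
    moreover have "real (Suc t) = K + 3" "real t = K + 2" "real p + 1 = Q + 2"
      by (simp_all add: t p Suc K_def Q_def)
    ultimately show ?thesis by (simp only:)
  qed
qed

lemma g_of_1: "1 \<le> p \<Longrightarrow> g_of p \<beta> 1 = 1"
  by (simp add: g_of_def g_edge_def)

lemma g_of_top:
  assumes "1 \<le> p"
  shows "g_of p \<beta> (Suc p) = g_edge p \<beta> (Suc p)"
  using assms by (simp add: g_of_def binomial_eq_0)

lemma g_of_0: "\<lbrakk>1 \<le> p; p + 2 \<le> t\<rbrakk> \<Longrightarrow> g_of p \<beta> t = 0"
  by (auto simp: g_of_def g_edge_def binomial_eq_0)

lemma g_edge_nonneg:
  assumes "0 \<le> \<beta>" "real p * \<beta> \<le> 1"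
  shows "0 \<le> g_edge p \<beta> t"
proof -
  have "real (p - 1) * \<beta> \<le> real p * \<beta>" using assms by (intro mult_right_mono) auto
  then show ?thesis using assms by (auto simp: g_edge_def)
qed

lemma g_edge_top_pos:
  assumes "0 < \<beta>" "real p * \<beta> < 1" "1 \<le> p"
  shows "0 < g_edge p \<beta> (Suc p)"
proof -
  have "real (p - 1) * \<beta> \<le> real p * \<beta>" using assms by (intro mult_right_mono) auto
  then have "0 < (1 - real p * \<beta>) * (1 - real (p - 1) * \<beta>) / 2"
    using assms(2) by (intro divide_pos_pos mult_pos_pos) linarith+
  then show ?thesis
    using assms by (simp only: g_edge_def) (simp del: of_nat_diff)
qed

text \<open>
  \<open>L = min 1 (\<kappa> (p+1) / g_of p \<beta> (p+1))\<close> would be less than 1 if the bound failed at \<open>p+1\<close>;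
  feeding it through the recursion for \<open>\<kappa>\<close> then contradicts the definition of \<open>L\<close>.
\<close>
lemma recursion_bound:
  fixes \<kappa> X Y Z :: "nat \<Rightarrow> real" and \<beta> \<gamma> M \<eta> :: real
  assumes p: "2 \<le> p" and \<beta>: "1 / (real p + 1) \<le> \<beta>" and \<gamma>: "\<gamma> = (real p + 1) * \<beta> - 1"
    and c: "1 / (2 * (real p + 1)) \<le> 1 - real p * \<beta>"
    and \<kappa>1: "\<kappa> 1 = 1"
    and \<kappa>_Suc: "\<And>t. \<lbrakk>1 \<le> t; t \<le> p\<rbrakk> \<Longrightarrow> real (Suc t) * \<kappa> (Suc t) = (1 - real t * \<beta>) * \<kappa> t + X t"
    and X: "\<And>t. X t = Y t + Z t" and X1: "0 \<le> X 1" and Z0: "\<And>t. 0 \<le> Z t"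
    and Y: "\<And>t. \<lbrakk>2 \<le> t; t \<le> p\<rbrakk> \<Longrightarrow> (real t - 1) * Y (Suc t) \<le> (real p + 1 - real t) * \<beta> * Y t + \<gamma> * Z t"
    and Ytop: "Y (Suc p) = \<gamma> * \<kappa> (Suc p)"
    and M: "1 \<le> M" and ZM: "\<And>t. \<lbrakk>2 \<le> t; t \<le> p\<rbrakk> \<Longrightarrow> Z t \<le> M * Z 2"
    and \<eta>: "\<gamma> * M * (real p + 1) ^ (2 * p) \<le> (1 / (4 * (real p + 1) ^ 2)) ^ (p + 2)"
  shows "\<And>t. \<lbrakk>1 \<le> t; t \<le> Suc p\<rbrakk> \<Longrightarrow> g_of p \<beta> t \<le> \<kappa> t"
    and "\<And>t. \<lbrakk>3 \<le> t; t \<le> Suc p\<rbrakk> \<Longrightarrow> g_of p \<beta> t + (1 / (4 * (real p + 1) ^ 2)) ^ t * Z 2 \<le> \<kappa> t"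
    and "\<And>t. \<lbrakk>Z 2 = 0; 2 \<le> t; t \<le> p\<rbrakk> \<Longrightarrow> \<gamma> * g_edge p \<beta> t \<le> X t"
proof -
  \<comment> \<open>\<open>B\<close> is the growth rate of the error on the way down,
    \<open>k0\<close> a lower bound for the fraction of the surplus surviving each step up, and
    \<open>H\<close> a bound for every accumulated error coefficient.\<close>
  define B where "B = (real p + 1) ^ 2"
  define k0 where "k0 = 1 / (4 * B)"
  define c0 where "c0 = 1 / (2 * (real p + 1))"
  define \<rho> where "\<rho> = \<kappa> (Suc p) / g_of p \<beta> (Suc p)"
  define L where "L = min \<rho> 1"
  define H where "H = \<gamma> * M * B ^ p"
  have p1: "1 \<le> p" using p by simp
  have B1: "9 \<le> B" using power_mono[of 3 "real p + 1" 2] p by (simp add: B_def)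
  have \<gamma>0: "0 \<le> \<gamma>" using \<beta> by (simp add: \<gamma> field_simps)
  have \<beta>0: "0 < \<beta>" using \<beta> by (smt (verit) divide_pos_pos of_nat_0_le_iff)
  have c0: "0 < c0" "c0 \<le> 1" by (simp_all add: c0_def field_simps)
  have c0_le: "c0 \<le> 1 - real t * \<beta>" if "t \<le> p" for t
  proof -
    have "real t * \<beta> \<le> real p * \<beta>" using that \<beta>0 by (intro mult_right_mono) auto
    then show ?thesis using c by (simp add: c0_def)
  qed
  have k0: "0 < k0" "k0 \<le> 1 / 36" using B1 by (auto simp: k0_def field_simps)
  have c0k0: "c0 / 2 / (real p + 1) = k0"
    by (simp add: c0_def k0_def B_def power2_eq_square)
  have k0c0: "2 * k0 \<le> c0"
  proof -
    have "c0 = 2 * k0 * (real p + 1)" using c0k0 by (simp add: field_simps)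
    moreover have "2 * k0 * 1 \<le> 2 * k0 * (real p + 1)" using k0 by (intro mult_left_mono) auto
    ultimately show ?thesis by simp
  qed
  have H0: "0 \<le> H" using \<gamma>0 M B1 by (simp add: H_def)
  have Hk: "H \<le> k0 ^ (p + 2)" using \<eta> by (simp add: H_def B_def k0_def power_mult)
  have Hkt: "H \<le> k0 * k0 ^ t" if "t \<le> p + 1" for t
  proof -
    have "k0 ^ (p + 2) \<le> k0 ^ Suc t" using that k0 by (intro power_decreasing) auto
    then show ?thesis using Hk by simp
  qed
  have pb: "real p * \<beta> < 1" using c0_le[of p] c0 by simp
  have gpos: "0 < g_of p \<beta> (Suc p)"
    using g_of_top[OF p1] g_edge_top_pos[OF \<beta>0 pb p1] by simp
  have edge0: "0 \<le> g_edge p \<beta> t" for t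
    by (rule g_edge_nonneg) (use \<beta>0 pb in auto)
  \<comment> \<open>Descent from size \<open>p + 1\<close>, where \<open>Ytop\<close> and the
    definition of \<open>\<rho>\<close> give equality, to size 2; \<open>i\<close> counts the
    steps.\<close>
  have Ylow: "\<rho> * \<gamma> * g_edge p \<beta> (Suc p - i) - \<gamma> * M * (B ^ i - 1) * Z 2 \<le> Y (Suc p - i)" if "i < p" for i
    using that
  proof (induction i)
    case 0
    then show ?case using g_of_top[OF p1] gpos by (simp add: Ytop \<rho>_def)
  next
    case (Suc i)
    define t where "t = p - i"
    have t: "2 \<le> t" "t \<le> p" "Suc p - Suc i = t" "Suc p - i = Suc t" using Suc.prems by (auto simp: t_def)
    define \<alpha> where "\<alpha> = (real p + 1 - real t) * \<beta>"
    have "1 * \<beta> \<le> \<alpha>" unfolding \<alpha>_def using t \<beta>0 by (intro mult_right_mono) auto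
    then have \<alpha>: "\<beta> \<le> \<alpha>" "0 < \<alpha>" using \<beta>0 by auto
    have ih: "\<rho> * \<gamma> * g_edge p \<beta> (Suc t) - \<gamma> * M * (B ^ i - 1) * Z 2 \<le> Y (Suc t)"
      using Suc t by simp
    have "(real t - 1) * (\<rho> * \<gamma> * g_edge p \<beta> (Suc t) - \<gamma> * M * (B ^ i - 1) * Z 2) \<le> (real t - 1) * Y (Suc t)"
      using ih t by (intro mult_left_mono) auto
    also have "\<dots> \<le> \<alpha> * Y t + \<gamma> * Z t" using Y[of t] t by (simp add: \<alpha>_def)
    also have "\<dots> \<le> \<alpha> * Y t + \<gamma> * (M * Z 2)" using ZM[of t] t \<gamma>0 by (simp add: mult_left_mono)
    finally have 1: "\<rho> * \<gamma> * ((real t - 1) * g_edge p \<beta> (Suc t)) - (real t - 1) * (\<gamma> * M * (B ^ i - 1) * Z 2)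
        \<le> \<alpha> * Y t + \<gamma> * M * Z 2" by (simp add: algebra_simps)
    \<comment> \<open>One step of the descent multiplies the error coefficient by
      \<open>t - 1\<close>, adds 1 and divides by \<open>\<alpha> \<ge> 1 / (p + 1)\<close>. The
      choice \<open>B = (p + 1) ^ 2\<close> absorbs all three effects.\<close>
    have "(real t - 1) * (B ^ i - 1) + 1 \<le> \<beta> * (B ^ Suc i - 1)"
    proof -
      have Bi: "1 \<le> B ^ i" using B1 by (intro one_le_power) auto
      have "(real t - 1) * (B ^ i - 1) \<le> (real p - 1) * (B ^ i - 1)"
        using t Bi by (intro mult_right_mono) auto
      then have "(real t - 1) * (B ^ i - 1) + 1 \<le> (real p - 1) * (B ^ i - 1) + 1" by simp
      also have "\<dots> \<le> (real p + 1) * B ^ i - 1"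
        using p Bi by (simp add: algebra_simps)
      also have "\<dots> \<le> (real p + 1) * B ^ i - 1 / (real p + 1)" by (simp add: field_simps)
      also have "\<dots> = 1 / (real p + 1) * (B ^ Suc i - 1)" by (simp add: B_def field_simps power2_eq_square)
      also have "\<dots> \<le> \<beta> * (B ^ Suc i - 1)" using \<beta> B1 one_le_power[of B "Suc i"] by (intro mult_right_mono) auto
      finally show ?thesis .
    qed
    also have "\<dots> \<le> \<alpha> * (B ^ Suc i - 1)" using \<alpha> B1 one_le_power[of B "Suc i"] by (intro mult_right_mono) auto
    finally have "(\<gamma> * M * Z 2) * ((real t - 1) * (B ^ i - 1) + 1) \<le> (\<gamma> * M * Z 2) * (\<alpha> * (B ^ Suc i - 1))"
      using \<gamma>0 M Z0[of 2] by (intro mult_left_mono) auto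
    then have "\<rho> * \<gamma> * ((real t - 1) * g_edge p \<beta> (Suc t)) - \<alpha> * (\<gamma> * M * (B ^ Suc i - 1) * Z 2) \<le> \<alpha> * Y t"
      using 1 by (simp add: algebra_simps)
    then have "\<rho> * \<gamma> * (\<alpha> * g_edge p \<beta> t) - \<alpha> * (\<gamma> * M * (B ^ Suc i - 1) * Z 2) \<le> \<alpha> * Y t"
      using g_edge_Suc[OF t(1) p1, of \<beta>] by (simp only: \<alpha>_def)
    then have "\<alpha> * (\<rho> * \<gamma> * g_edge p \<beta> t - \<gamma> * M * (B ^ Suc i - 1) * Z 2) \<le> \<alpha> * Y t"
      by (simp only: right_diff_distrib mult_ac)
    then show ?case using \<alpha> t by simp
  qed
  \<comment> \<open>\<open>Z t\<close> enters with coefficient 1, whereas the errors carry only the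
    tiny coefficient \<open>H\<close>; this is how overshoot pays for its own error.\<close>
  have Xlow: "L * \<gamma> * g_edge p \<beta> t - H * Z 2 + Z t \<le> X t" if t: "2 \<le> t" "t \<le> p" for t
  proof -
    have "L * (\<gamma> * g_edge p \<beta> t) \<le> \<rho> * (\<gamma> * g_edge p \<beta> t)"
      using \<gamma>0 edge0 by (intro mult_right_mono) (auto simp: L_def)
    moreover have "\<gamma> * M * (B ^ (Suc p - t) - 1) * Z 2 \<le> H * Z 2"
    proof -
      have "B ^ (Suc p - t) \<le> B ^ p" using B1 t by (intro power_increasing) auto
      then have "\<gamma> * M * (B ^ (Suc p - t) - 1) \<le> \<gamma> * M * B ^ p"
        using \<gamma>0 M by (intro mult_left_mono) auto
      then show ?thesis using Z0[of 2] by (simp add: H_def mult_right_mono)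
    qed
    moreover have "\<rho> * \<gamma> * g_edge p \<beta> t - \<gamma> * M * (B ^ (Suc p - t) - 1) * Z 2 \<le> Y t"
    proof -
      have "Suc p - t < p" "Suc p - (Suc p - t) = t" using t by auto
      then show ?thesis using Ylow[of "Suc p - t"] by simp
    qed
    ultimately show ?thesis using X[of t] by (simp add: mult.assoc)
  qed
  \<comment> \<open>The surplus over \<open>L\<close> times the extremal values obeys a linear
    recursion and starts from \<open>1 - L \<ge> 0\<close>.\<close>
  define e where "e = (\<lambda>t. \<kappa> t - L * g_of p \<beta> t)"
  have eSuc: "real (Suc t) * e (Suc t) = (1 - real t * \<beta>) * e t + (X t - L * \<gamma> * g_edge p \<beta> t)"
    if "1 \<le> t" "t \<le> p" for t
    using \<kappa>_Suc[OF that] g_of_Suc[OF that(1) p1, of \<beta>] unfolding e_def \<gamma>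
    by (simp only: right_diff_distrib mult.left_commute[of "real (Suc t)" L]) (simp add: algebra_simps)
  have divide_step: "k0 * w \<le> a" if "c0 / 2 * w \<le> real (Suc t) * a" "0 \<le> w" "t \<le> p" for t w a
  proof -
    have "c0 / 2 * w / real (Suc t) \<le> a" using that(1) by (simp add: field_simps)
    moreover have "c0 / 2 * w / (real p + 1) \<le> c0 / 2 * w / real (Suc t)"
      using that c0 by (intro divide_left_mono) auto
    ultimately show ?thesis unfolding c0k0[symmetric] by simp
  qed
  have L1: "0 \<le> 1 - L" by (simp add: L_def)
  have e1: "e 1 = 1 - L" by (simp add: e_def \<kappa>1 g_of_1[OF p1] del: One_nat_def)
  have e2: "k0 ^ 2 * (1 - L) \<le> e 2"
  proof -
    have "c0 / 2 * (k0 * (1 - L)) \<le> c0 * (1 - L)"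
    proof -
      have "c0 / 2 * k0 \<le> c0 * 1" using k0 c0 by (intro mult_mono) auto
      then show ?thesis using mult_right_mono[OF _ L1, of "c0 / 2 * k0" c0] by (simp add: mult.assoc)
    qed
    also have "\<dots> \<le> (1 - real 1 * \<beta>) * e 1"
      using c0_le[of 1] p L1 unfolding e1 by (intro mult_right_mono) auto
    also have "\<dots> \<le> real (Suc 1) * e (Suc 1)"
      using eSuc[of 1] X1 p by (simp add: g_edge_def)
    finally have "k0 * (k0 * (1 - L)) \<le> e (Suc 1)"
      using divide_step[of "k0 * (1 - L)" 1 "e (Suc 1)"] k0 L1 p by simp
    then show ?thesis by (simp add: power2_eq_square numeral_2_eq_2)
  qed
  \<comment> \<open>From size 3 on the surplus contains a share of \<open>Z 2\<close>, picked up in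
    the step from 2 to 3; the later errors \<open>H * Z 2\<close> take at most half of it in each
    step.\<close>
  have e3: "k0 ^ t * (1 - L + Z 2) \<le> e t" if "3 \<le> t" "t \<le> Suc p" for t
    using that
  proof (induction t rule: dec_induct)
    case base
    have "c0 / 2 * (k0 ^ 2 * (1 - L + Z 2)) \<le> c0 * (k0 ^ 2 * (1 - L)) + (1 - H) * Z 2"
    proof -
      have "H \<le> 1 / 2" using Hkt[of 0] k0 by simp
      moreover have "c0 / 2 * k0 ^ 2 \<le> 1 / 2 * 1"
        using c0 k0 by (intro mult_mono) (auto simp: power_le_one)
      ultimately have "c0 / 2 * k0 ^ 2 * Z 2 \<le> (1 - H) * Z 2" using Z0[of 2] by (intro mult_right_mono) auto
      moreover have "0 \<le> c0 * (k0 ^ 2 * (1 - L))" using c0 k0 L1 by simp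
      ultimately show ?thesis by (simp add: algebra_simps)
    qed
    also have "\<dots> \<le> (1 - real 2 * \<beta>) * e 2 + (1 - H) * Z 2"
      using c0_le[of 2] p e2 k0 c0 L1 by (intro add_right_mono mult_mono) auto
    also have "\<dots> \<le> real (Suc 2) * e (Suc 2)"
      using eSuc[of 2] Xlow[of 2] p by (simp add: algebra_simps)
    finally have "k0 * (k0 ^ 2 * (1 - L + Z 2)) \<le> e (Suc 2)"
      using divide_step[of "k0 ^ 2 * (1 - L + Z 2)" 2 "e (Suc 2)"] k0 L1 p Z0[of 2] by simp
    then show ?case by (simp add: numeral_3_eq_3 numeral_2_eq_2)
  next
    case (step t)
    then have t: "2 \<le> t" "t \<le> p" by auto
    have ih: "k0 ^ t * (1 - L + Z 2) \<le> e t" using step by simp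
    have "H * Z 2 \<le> c0 / 2 * k0 ^ t * Z 2"
    proof -
      have "H \<le> k0 * k0 ^ t" using Hkt[of t] t by simp
      also have "\<dots> \<le> c0 / 2 * k0 ^ t" using k0c0 k0 by (intro mult_right_mono) auto
      finally show ?thesis using Z0[of 2] by (intro mult_right_mono)
    qed
    moreover have "0 \<le> c0 / 2 * k0 ^ t * (1 - L)" using c0 k0 L1 by simp
    ultimately have "c0 / 2 * (k0 ^ t * (1 - L + Z 2)) \<le> c0 * (k0 ^ t * (1 - L + Z 2)) - H * Z 2"
      by (simp add: algebra_simps)
    also have "\<dots> \<le> (1 - real t * \<beta>) * e t - H * Z 2"
      using c0_le[of t] t ih k0 c0 L1 Z0[of 2] by (intro diff_right_mono mult_mono) auto
    also have "\<dots> \<le> real (Suc t) * e (Suc t)"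
      using eSuc[of t] Xlow[of t] Z0[of t] t by simp
    finally have "k0 * (k0 ^ t * (1 - L + Z 2)) \<le> e (Suc t)"
      using divide_step[of "k0 ^ t * (1 - L + Z 2)" t "e (Suc t)"] k0 L1 t Z0[of 2] by simp
    then show ?case by simp
  qed
  have "L = 1"
  proof (rule ccontr)
    assume "L \<noteq> 1"
    then have L: "L = \<rho>" "L < 1" by (auto simp: L_def)
    have "e (Suc p) = 0" using gpos by (simp add: e_def L \<rho>_def)
    moreover have "0 < k0 ^ Suc p * (1 - L + Z 2)" using k0 L Z0[of 2] by (intro mult_pos_pos) auto
    ultimately show False using e3[of "Suc p"] p by simp
  qed
  show "\<gamma> * g_edge p \<beta> t \<le> X t" if "Z 2 = 0" "2 \<le> t" "t \<le> p" for t
    using Xlow[OF that(2,3)] that(1) Z0[of t] \<open>L = 1\<close> by simp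
  show **: "\<And>t. \<lbrakk>3 \<le> t; t \<le> Suc p\<rbrakk> \<Longrightarrow> g_of p \<beta> t + (1 / (4 * (real p + 1) ^ 2)) ^ t * Z 2 \<le> \<kappa> t"
    using e3 \<open>L = 1\<close> by (simp add: e_def k0_def B_def algebra_simps)
  show "g_of p \<beta> t \<le> \<kappa> t" if "1 \<le> t" "t \<le> Suc p" for t
  proof -
    have "t = 1 \<or> t = 2 \<or> 3 \<le> t" using that by arith
    then consider "t = 1" | "t = 2" | "3 \<le> t" by blast
    then show ?thesis
    proof cases
      case 3
      have "0 \<le> (1 / (4 * (real p + 1) ^ 2)) ^ t * Z 2" using Z0[of 2] by simp
      then show ?thesis using **[OF 3 that(2)] by linarith
    qed (use e1 e2 \<open>L = 1\<close> in \<open>auto simp: e_def\<close>)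
  qed
qed

text \<open>Subtracting the recursion of \<open>g_of\<close> from that of \<open>\<kappa>\<close>
  leaves two nonnegative terms, so equality at \<open>t + 1\<close> forces equality at
  \<open>t\<close> and in the excess. The descent starts at \<open>r\<close>, which may be 3, so the
  conclusion concerns sizes 1 and 2 only.\<close>

lemma recursion_tight:
  fixes \<kappa> X :: "nat \<Rightarrow> real" and \<beta> \<gamma> :: real
  assumes p: "2 \<le> p" and \<gamma>: "\<gamma> = (real p + 1) * \<beta> - 1"
    and pos: "\<And>t. t \<le> p \<Longrightarrow> 0 < 1 - real t * \<beta>"
    and \<kappa>_Suc: "\<And>t. \<lbrakk>1 \<le> t; t \<le> p\<rbrakk> \<Longrightarrow> real (Suc t) * \<kappa> (Suc t) = (1 - real t * \<beta>) * \<kappa> t + X t"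
    and X1: "0 \<le> X 1" and X: "\<And>t. \<lbrakk>2 \<le> t; t \<le> p\<rbrakk> \<Longrightarrow> \<gamma> * g_edge p \<beta> t \<le> X t"
    and ge: "\<And>t. \<lbrakk>1 \<le> t; t \<le> Suc p\<rbrakk> \<Longrightarrow> g_of p \<beta> t \<le> \<kappa> t"
    and r: "3 \<le> r" "r \<le> Suc p" "\<kappa> r = g_of p \<beta> r"
  shows "X 1 = 0" "X 2 = \<gamma> * g_edge p \<beta> 2"
proof -
  have s0: "0 \<le> X t - \<gamma> * g_edge p \<beta> t" if "1 \<le> t" "t \<le> p" for t
    using X1 X[of t] that by (cases "t = 1") (auto simp: g_edge_def)
  have down: "\<kappa> t = g_of p \<beta> t \<and> X t = \<gamma> * g_edge p \<beta> t"
    if t: "1 \<le> t" "t \<le> p" "\<kappa> (Suc t) = g_of p \<beta> (Suc t)" for t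
  proof -
    have p1: "1 \<le> p" using p by simp
    have "(1 - real t * \<beta>) * (\<kappa> t - g_of p \<beta> t) + (X t - \<gamma> * g_edge p \<beta> t) = 0"
      using \<kappa>_Suc[OF t(1,2)] g_of_Suc[OF t(1) p1, of \<beta>] t(3) by (simp add: \<gamma> algebra_simps)
    moreover have "0 \<le> (1 - real t * \<beta>) * (\<kappa> t - g_of p \<beta> t)"
      using ge[of t] pos[of t] t by simp
    ultimately have "(1 - real t * \<beta>) * (\<kappa> t - g_of p \<beta> t) = 0" "X t - \<gamma> * g_edge p \<beta> t = 0"
      using s0[OF t(1,2)] by linarith+
    then show ?thesis using pos[OF t(2)] by auto
  qed
  have "\<kappa> 3 = g_of p \<beta> 3"
    using r(1) r(3)
  proof (induction rule: inc_induct)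
    case (step t)
    then show ?case using down[of t] r by auto
  qed
  then have 2: "\<kappa> 2 = g_of p \<beta> 2 \<and> X 2 = \<gamma> * g_edge p \<beta> 2"
    using down[of 2] p by (simp add: numeral_3_eq_3 numeral_2_eq_2)
  then show "X 2 = \<gamma> * g_edge p \<beta> 2" by simp
  have "X 1 = \<gamma> * g_edge p \<beta> 1"
    using down[of 1] 2 p by (simp add: numeral_2_eq_2)
  then show "X 1 = 0" by (simp add: g_edge_def)
qed

section \<open>Minimum degree close to the Turan value\<close>

text \<open>The factor \<open>2 * (p + 1)\<close> comes from \<open>kappa_Z\<close>, the factor
  \<open>p + 2\<close> from \<open>Z_top\<close>, and the power from at most \<open>p\<close> steps
  of cost \<open>2 * (p + 1) ^ 2\<close> each in \<open>Z_le\<close>.\<close>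

definition Z_const :: "nat \<Rightarrow> real" where
  "Z_const p = 2 * (real p + 1) * (real p + 2) * (2 * (real p + 1) ^ 2) ^ p"

text \<open>\<open>small1\<close> keeps the level \<open>3 ^ p * \<gamma>\<close> reached by the
  iterated descent below half of \<open>1 / (p + 1)\<close>; \<open>small2\<close> is the smallness
  condition of \<open>recursion_bound\<close> with \<open>M = Z_const p\<close>.\<close>

locale near_turan = min_degree_graph +
  fixes p :: nat
  assumes p2: "2 \<le> p" and \<beta>_ge: "1 / (real p + 1) \<le> \<beta>"
    and small1: "((real p + 1) * \<beta> - 1) * (2 * (real p + 1) * 3 ^ p) \<le> 1"
    and small2: "((real p + 1) * \<beta> - 1) * Z_const p * (real p + 1) ^ (2 * p)
      \<le> (1 / (4 * (real p + 1) ^ 2)) ^ (p + 2)"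
begin

abbreviation "\<gamma> \<equiv> (real p + 1) * \<beta> - 1"
abbreviation "X \<equiv> avg x"
abbreviation "Y \<equiv> avg (trunc \<gamma>)"
abbreviation "Z \<equiv> avg (over \<gamma>)"

lemma \<gamma>_nonneg: "0 \<le> \<gamma>"
  using \<beta>_ge by (simp add: field_simps)

definition "c0 = 1 / (2 * (real p + 1))"

lemma c0_pos: "0 < c0"
  by (simp add: c0_def)

lemma c0_le_\<beta>: "c0 + c0 \<le> \<beta>"
proof -
  have "c0 + c0 = 1 / (real p + 1)" by (simp add: c0_def field_simps)
  then show ?thesis using \<beta>_ge by simp
qed

lemma \<gamma>_le: "3 ^ p * \<gamma> \<le> c0"
  using small1 by (simp add: c0_def field_simps)

lemma \<gamma>_le': "\<gamma> \<le> c0"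
proof -
  have "1 * \<gamma> \<le> 3 ^ p * \<gamma>" using \<gamma>_nonneg by (intro mult_right_mono) auto
  then show ?thesis using \<gamma>_le by simp
qed

lemma \<beta>_pos: "0 < \<beta>"
  using c0_pos c0_le_\<beta> by simp

text \<open>\<open>1 - p * \<beta>\<close> equals \<open>\<beta> - \<gamma>\<close>, where
  \<open>\<beta>\<close> is at least \<open>2 * c0\<close> and \<open>\<gamma>\<close> at most
  \<open>c0\<close>.\<close>

lemma density_ge:
  assumes "t \<le> p"
  shows "c0 \<le> 1 - real t * \<beta>"
proof -
  have "real t * \<beta> \<le> real p * \<beta>" using assms \<beta>_pos by (intro mult_right_mono) auto
  moreover have "1 - real p * \<beta> = \<beta> - \<gamma>" by (simp add: algebra_simps)
  ultimately show ?thesis using \<gamma>_le' c0_le_\<beta> by simp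
qed

lemma density_pos: "t \<le> p \<Longrightarrow> 0 < 1 - real t * \<beta>"
  using density_ge[of t] c0_pos by linarith

lemma exc_top: "T \<in> K (Suc p) \<Longrightarrow> \<gamma> \<le> x T"
  using exc_ge[of T "Suc p"] by (simp add: algebra_simps)

text \<open>Every \<open>(p + 1)\<close>-clique has excess at least \<open>\<gamma>\<close>, so its
  truncated excess is exactly \<open>\<gamma>\<close>. This starts the descent in
  \<open>recursion_bound\<close>.\<close>

lemma Y_top: "Y (Suc p) = \<gamma> * \<kappa> (Suc p)"
proof -
  have "Y (Suc p) = avg (\<lambda>_. \<gamma> * 1) (Suc p)"
    by (rule avg_cong) (simp only: min.absorb2[OF exc_top] mult_1_right)
  then show ?thesis by (simp only: avg_cmult)
qed

text \<open>A \<open>(p + 2)\<close>-clique has excess at least \<open>\<beta> + \<gamma>\<close>,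
  which exceeds the level \<open>3 ^ p * \<gamma>\<close> by at least \<open>c0\<close>, and such
  overshoot descends to edges.\<close>

lemma kappa_Z: "\<kappa> (p + 2) \<le> 2 * (real p + 1) * Z 2"
proof -
  have "c0 * \<kappa> (p + 2) = avg (\<lambda>_. c0 * 1) (p + 2)"
    by (rule avg_cmult[symmetric])
  also have "\<dots> \<le> avg (over (3 ^ p * \<gamma>)) (p + 2)"
  proof (rule avg_mono)
    fix U assume "U \<in> K (p + 2)"
    then have "\<beta> + \<gamma> \<le> x U" using exc_ge[of U "p + 2"] by (simp add: algebra_simps)
    then have "c0 \<le> x U - 3 ^ p * \<gamma>"
      using \<gamma>_le c0_le_\<beta> \<gamma>_nonneg by linarith
    then show "c0 * 1 \<le> over (3 ^ p * \<gamma>) U" by simp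
  qed
  also have "\<dots> \<le> Z 2" by (rule avg_over_2_ge[OF \<gamma>_nonneg])
  finally show ?thesis by (simp add: c0_def field_simps)
qed

text \<open>At size \<open>p + 1\<close> the baseline \<open>1 - (p + 1) * \<beta>\<close> is
  \<open>- \<gamma>\<close> and cancels against \<open>Y_top\<close> in
  \<open>kappa_Suc\<close>.\<close>

lemma Z_top: "Z (Suc p) = (real p + 2) * \<kappa> (p + 2)"
  using kappa_Suc[of "Suc p"] avg_exc_split[of "Suc p" \<gamma>] Y_top by (simp add: algebra_simps)

text \<open>Starting from \<open>Z_top\<close> and \<open>kappa_Z\<close>,
  \<open>avg_over_le_Suc\<close> is applied downwards at a cost of \<open>2 * (p + 1) ^ 2\<close>
  per step. Size 0 is separate: it would take one step too many, but the empty clique has excess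
  0.\<close>

lemma Z_le: "t \<le> p \<Longrightarrow> Z t \<le> Z_const p * Z 2"
proof -
  define N where "N = 2 * (real p + 1) ^ 2"
  define W where "W = 2 * (real p + 1) * (real p + 2) * Z 2"
  have Z2: "0 \<le> Z 2" by (rule avg_over_nonneg)
  then have W0: "0 \<le> W" by (simp add: W_def)
  have "1 \<le> (real p + 1) ^ 2" by (rule one_le_power) simp
  then have N1: "1 \<le> N" unfolding N_def by linarith
  have *: "i \<le> Suc p \<Longrightarrow> Z (Suc p - i) \<le> N ^ i * W" for i
  proof (induction i)
    case 0
    have "(real p + 2) * \<kappa> (p + 2) \<le> (real p + 2) * (2 * (real p + 1) * Z 2)"
      using kappa_Z by (intro mult_left_mono) auto
    also have "\<dots> = W" by (simp add: W_def)
    finally show ?case unfolding Z_top[symmetric] by simp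
  next
    case (Suc i)
    define t where "t = p - i"
    have t: "t \<le> p" "Suc p - Suc i = t" "Suc p - i = Suc t" using Suc.prems by (auto simp: t_def)
    have "c0 * Z t \<le> real (Suc t) * Z (Suc t)"
      by (rule avg_over_le_Suc) (use density_ge c0_pos t in auto)
    also have "\<dots> \<le> (real p + 1) * (N ^ i * W)"
      using Suc t avg_over_nonneg[of \<gamma> "Suc t"] by (intro mult_mono) auto
    finally have "Z t \<le> (2 * (real p + 1)) * ((real p + 1) * (N ^ i * W))"
      by (simp add: c0_def field_simps)
    also have "\<dots> = N ^ Suc i * W" by (simp add: N_def power2_eq_square)
    finally show ?case using t by simp
  qed
  assume "t \<le> p"
  show ?thesis
  proof (cases "t = 0")
    case True
    have "x {} = 0" using n_pos by (simp add: exc_def)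
    moreover have "S = {}" if "S \<in> K 0" for S using cliquesD[OF that] by simp
    ultimately have "Z 0 = avg (\<lambda>_. 0 * 1) 0"
      using \<gamma>_nonneg by (intro avg_cong) force
    then have "Z 0 = 0" by (simp only: avg_cmult)
    then show ?thesis using True Z2 by (simp add: Z_const_def)
  next
    case False
    have "Z t \<le> N ^ (Suc p - t) * W"
      using *[of "Suc p - t"] \<open>t \<le> p\<close> by simp
    also have "\<dots> \<le> N ^ p * W"
      using False N1 W0 by (intro mult_right_mono power_increasing) auto
    also have "\<dots> = Z_const p * Z 2" by (simp add: Z_const_def N_def W_def)
    finally show ?thesis .
  qed
qed

lemma Y_Suc: "(real t - 1) * Y (Suc t) + avg (\<lambda>S. trunc \<gamma> S * (\<gamma> - trunc \<gamma> S)) t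
   \<le> (real p + 1 - real t) * \<beta> * Y t + \<gamma> * Z t"
  using avg_trunc_Suc[OF \<gamma>_nonneg, of t] by (simp add: algebra_simps)

lemma trunc_gap_nonneg: "S \<in> K t \<Longrightarrow> 0 \<le> trunc \<gamma> S * (\<gamma> - trunc \<gamma> S)"
  using exc_nonneg'[of S t] \<gamma>_nonneg by (intro mult_nonneg_nonneg) auto

lemma avg_gap_nonneg: "0 \<le> avg (\<lambda>S. trunc \<gamma> S * (\<gamma> - trunc \<gamma> S)) t"
  by (rule avg_nonneg) (rule trunc_gap_nonneg)

lemma kappa_ge:
  shows "\<And>t. \<lbrakk>1 \<le> t; t \<le> Suc p\<rbrakk> \<Longrightarrow> g_of p \<beta> t \<le> \<kappa> t"
    and "\<And>t. \<lbrakk>3 \<le> t; t \<le> Suc p\<rbrakk> \<Longrightarrow> g_of p \<beta> t + (1 / (4 * (real p + 1) ^ 2)) ^ t * Z 2 \<le> \<kappa> t"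
    and "\<And>t. \<lbrakk>Z 2 = 0; 2 \<le> t; t \<le> p\<rbrakk> \<Longrightarrow> \<gamma> * g_edge p \<beta> t \<le> X t"
proof -
  have Y': "(real t - 1) * Y (Suc t) \<le> (real p + 1 - real t) * \<beta> * Y t + \<gamma> * Z t" for t
    using Y_Suc[of t] avg_gap_nonneg[of t] by linarith
  have c1: "1 \<le> Z_const p"
  proof -
    have "1 \<le> (2 * (real p + 1) ^ 2) ^ p"
    proof (rule one_le_power)
      have "1 \<le> (real p + 1) ^ 2" by (rule one_le_power) simp
      then show "1 \<le> 2 * (real p + 1) ^ 2" by linarith
    qed
    moreover have "1 \<le> (2 * (real p + 1)) * (real p + 2)"
      using mult_mono[of 1 "2 * (real p + 1)" 1 "real p + 2"] by simp
    ultimately show ?thesis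
      unfolding Z_const_def using mult_mono[of 1 "2 * (real p + 1) * (real p + 2)" 1] by fastforce
  qed
  note * = recursion_bound[where \<kappa> = \<kappa> and X = X and Y = Y and Z = Z and \<beta> = \<beta> and M = "Z_const p",
      OF p2 \<beta>_ge refl density_ge[OF order_refl, unfolded c0_def] kappa_1 kappa_Suc avg_exc_split avg_exc_nonneg
        avg_over_nonneg Y' Y_top c1 Z_le small2]
  show "\<And>t. \<lbrakk>1 \<le> t; t \<le> Suc p\<rbrakk> \<Longrightarrow> g_of p \<beta> t \<le> \<kappa> t" by (rule *(1))
  show "\<And>t. \<lbrakk>3 \<le> t; t \<le> Suc p\<rbrakk> \<Longrightarrow> g_of p \<beta> t + (1 / (4 * (real p + 1) ^ 2)) ^ t * Z 2 \<le> \<kappa> t" by (rule *(2))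
  show "\<And>t. \<lbrakk>Z 2 = 0; 2 \<le> t; t \<le> p\<rbrakk> \<Longrightarrow> \<gamma> * g_edge p \<beta> t \<le> X t" by (rule *(3))
qed

text \<open>The surplus term in \<open>kappa_ge\<close> forces \<open>Z 2 = 0\<close>, hence no
  overshoot up to size \<open>p\<close> and no \<open>(p + 2)\<close>-clique; \<open>X 1 = 0\<close>
  gives regularity.\<close>

lemma kappa_eqD:
  assumes r: "3 \<le> r" "r \<le> Suc p" "\<kappa> r = g_of p \<beta> r"
  shows "\<And>v. v < n \<Longrightarrow> real (degree {..<n} E v) = (1 - \<beta>) * real n"
    and "K (p + 2) = {}" and "K (Suc p) \<noteq> {}"
    and "\<And>S. S \<in> K p \<Longrightarrow> x S = 0 \<or> x S = \<gamma>"
proof -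
  have p1: "1 \<le> p" using p2 by simp
  have "(1 / (4 * (real p + 1) ^ 2)) ^ r * Z 2 \<le> 0" using kappa_ge(2)[OF r(1,2)] r(3) by simp
  moreover have "0 < (1 / (4 * (real p + 1) ^ 2)) ^ r" by (intro zero_less_power divide_pos_pos) auto
  ultimately have Z2: "Z 2 = 0"
    using avg_over_nonneg[of \<gamma> 2] by (simp add: mult_le_0_iff)
  have Zt: "Z t = 0" if "t \<le> p" for t
    using Z_le[OF that] avg_over_nonneg[of \<gamma> t] Z2 by simp
  have XY: "X t = Y t" if "t \<le> p" for t
    using avg_exc_split[of t \<gamma>] Zt[OF that] by simp
  have tight: "X 1 = 0" "X 2 = \<gamma> * g_edge p \<beta> 2"
    by (rule recursion_tight[where \<kappa> = \<kappa> and p = p, OF p2 refl density_pos kappa_Suc avg_exc_nonneg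
          kappa_ge(3)[OF Z2] kappa_ge(1) r]; assumption)+
  show "real (degree {..<n} E v) = (1 - \<beta>) * real n" if v: "v < n" for v
  proof -
    have "{v} \<in> K 1" unfolding cliques_1 using v by auto
    then have "x {v} = 0" using avg_eq_0D[OF tight(1)] exc_nonneg' by blast
    then show ?thesis using card_nbrs_eq[of "{v}" 1] by (simp add: card_nbrs_singleton mult.commute)
  qed
  show "K (p + 2) = {}"
  proof -
    have "\<kappa> (p + 2) \<le> 0" using kappa_Z Z2 by simp
    then have "real (kr n E (p + 2)) \<le> 0" using n_pos by (simp add: kappa_eq field_simps)
    then show ?thesis by (simp add: kr_def)
  qed
  have pb: "real p * \<beta> < 1" using density_pos[of p] by simp
  have top: "g_edge p \<beta> (Suc p) \<le> \<kappa> (Suc p)"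
    using kappa_ge(1)[of "Suc p"] g_of_top[OF p1] by simp
  show "K (Suc p) \<noteq> {}"
    using top g_edge_top_pos[OF \<beta>_pos pb p1] by (auto simp: avg_def)
  \<comment> \<open>An upper bound that climbs from the tight value at size 2, opposite in direction
    to the descent in \<open>recursion_bound\<close>.\<close>
  have Yle: "Y t \<le> \<gamma> * g_edge p \<beta> t" if "2 \<le> t" "t \<le> p" for t
    using that
  proof (induction t rule: dec_induct)
    case base
    then show ?case using tight(2) XY[of 2] p2 by simp
  next
    case (step t)
    have pos: "0 \<le> (real p + 1 - real t) * \<beta>" using step \<beta>_pos by (intro mult_nonneg_nonneg) auto
    have "(real t - 1) * Y (Suc t) \<le> (real p + 1 - real t) * \<beta> * Y t"
      using Y_Suc[of t] Zt[of t] avg_gap_nonneg[of t] step by simp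
    also have "\<dots> \<le> (real p + 1 - real t) * \<beta> * (\<gamma> * g_edge p \<beta> t)"
      using step pos by (intro mult_left_mono) auto
    also have "\<dots> = \<gamma> * ((real p + 1 - real t) * \<beta> * g_edge p \<beta> t)" by (simp only: mult_ac)
    also have "\<dots> = (real t - 1) * (\<gamma> * g_edge p \<beta> (Suc t))"
      unfolding g_edge_Suc[OF step(1) p1, symmetric] by (simp only: mult_ac)
    finally show ?case using step by simp
  qed
  \<comment> \<open>The upper bound for \<open>Y p\<close> meets the lower bound for
    \<open>Y (Suc p)\<close> given by the number of \<open>(p + 1)\<close>-cliques, which leaves no
    room for the gap term.\<close>
  have gap: "avg (\<lambda>S. trunc \<gamma> S * (\<gamma> - trunc \<gamma> S)) p \<le> 0"
  proof -
    have "avg (\<lambda>S. trunc \<gamma> S * (\<gamma> - trunc \<gamma> S)) p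
        \<le> (real p + 1 - real p) * \<beta> * Y p - (real p - 1) * (\<gamma> * \<kappa> (Suc p))"
      using Y_Suc[of p] Zt[of p] unfolding Y_top by simp
    also have "\<dots> \<le> (real p + 1 - real p) * \<beta> * (\<gamma> * g_edge p \<beta> p) - (real p - 1) * (\<gamma> * g_edge p \<beta> (Suc p))"
      using Yle[of p] p2 \<beta>_pos top \<gamma>_nonneg by (intro diff_mono mult_left_mono) auto
    also have "\<dots> = \<gamma> * ((real p + 1 - real p) * \<beta> * g_edge p \<beta> p - (real p - 1) * g_edge p \<beta> (Suc p))"
      by (simp add: algebra_simps)
    also have "\<dots> = 0" using g_edge_Suc[OF p2 p1] by simp
    finally show ?thesis .
  qed
  show "x S = 0 \<or> x S = \<gamma>" if S: "S \<in> K p" for S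
  proof -
    have "over \<gamma> S = 0" using avg_eq_0D[OF Zt[OF order_refl] _ S] by simp
    then have le: "x S \<le> \<gamma>" by simp
    have "avg (\<lambda>S. trunc \<gamma> S * (\<gamma> - trunc \<gamma> S)) p = 0"
      using gap avg_gap_nonneg[of p] by simp
    then have "trunc \<gamma> S * (\<gamma> - trunc \<gamma> S) = 0"
      using avg_eq_0D[where f = "\<lambda>S. trunc \<gamma> S * (\<gamma> - trunc \<gamma> S)" and t = p and S = S] trunc_gap_nonneg S
      by blast
    then have "x S * (\<gamma> - x S) = 0" by (simp only: min.absorb1[OF le])
    then show ?thesis unfolding mult_eq_0_iff by linarith
  qed
qed

end

section \<open>Clique counts of the family\<close>

text \<open>Going down from size \<open>p + 1\<close>, \<open>X\<close> is \<open>\<rho>\<close>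
  times the extremal value. Going up from size 1,
  \<open>\<kappa> t - \<rho> * g_of p \<beta> t\<close> is a positive multiple of
  \<open>1 - \<rho>\<close>. It vanishes at \<open>p + 1\<close> by the choice of
  \<open>\<rho>\<close>, so \<open>\<rho> = 1\<close>.\<close>

lemma recursion_solution:
  fixes \<kappa> X :: "nat \<Rightarrow> real" and \<beta> \<gamma> :: real
  assumes p: "1 \<le> p" and \<beta>: "0 < \<beta>" and \<gamma>: "\<gamma> = (real p + 1) * \<beta> - 1"
    and pos: "real p * \<beta> < 1"
    and \<kappa>1: "\<kappa> 1 = 1"
    and \<kappa>_Suc: "\<And>t. \<lbrakk>1 \<le> t; t \<le> p\<rbrakk> \<Longrightarrow> real (Suc t) * \<kappa> (Suc t) = (1 - real t * \<beta>) * \<kappa> t + X t"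
    and X1: "X 1 = 0"
    and X: "\<And>t. \<lbrakk>2 \<le> t; t \<le> p\<rbrakk> \<Longrightarrow> (real t - 1) * X (Suc t) = (real p + 1 - real t) * \<beta> * X t"
    and Xtop: "X (Suc p) = \<gamma> * \<kappa> (Suc p)"
    and r: "1 \<le> r" "r \<le> Suc p"
  shows "\<kappa> r = g_of p \<beta> r"
proof -
  define \<rho> where "\<rho> = \<kappa> (Suc p) / g_of p \<beta> (Suc p)"
  have gpos: "0 < g_of p \<beta> (Suc p)"
    using g_of_top[OF p] g_edge_top_pos[OF \<beta> pos p] by simp
  have Xg: "X (Suc p - i) = \<rho> * \<gamma> * g_edge p \<beta> (Suc p - i)" if "i < p" for i
    using that
  proof (induction i)
    case 0
    then show ?case using g_of_top[OF p] gpos by (simp add: Xtop \<rho>_def)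
  next
    case (Suc i)
    define t where "t = p - i"
    have t: "2 \<le> t" "t \<le> p" "Suc p - Suc i = t" "Suc p - i = Suc t" using Suc.prems by (auto simp: t_def)
    define \<alpha> where "\<alpha> = (real p + 1 - real t) * \<beta>"
    have \<alpha>: "0 < \<alpha>" unfolding \<alpha>_def using t \<beta> by (intro mult_pos_pos) auto
    have "\<alpha> * X t = (real t - 1) * X (Suc t)" using X t by (simp add: \<alpha>_def)
    also have "\<dots> = (real t - 1) * (\<rho> * \<gamma> * g_edge p \<beta> (Suc t))" using Suc t by simp
    also have "\<dots> = \<rho> * \<gamma> * ((real t - 1) * g_edge p \<beta> (Suc t))" by (simp only: mult_ac)
    also have "\<dots> = \<alpha> * (\<rho> * \<gamma> * g_edge p \<beta> t)"
      unfolding g_edge_Suc[OF t(1) p] \<alpha>_def by (simp only: mult_ac)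
    finally show ?case using \<alpha> t by simp
  qed
  have Xt: "X t = \<rho> * \<gamma> * g_edge p \<beta> t" if "1 \<le> t" "t \<le> p" for t
  proof (cases "t = 1")
    case False
    have "Suc p - t < p" "Suc p - (Suc p - t) = t" using that False by auto
    then show ?thesis using Xg[of "Suc p - t"] by simp
  qed (use X1 in \<open>simp add: g_edge_def\<close>)
  have *: "\<exists>c>0. \<kappa> t - \<rho> * g_of p \<beta> t = c * (1 - \<rho>)" if "1 \<le> t" "t \<le> Suc p" for t
    using that
  proof (induction t rule: dec_induct)
    case base
    then show ?case using \<kappa>1 g_of_1[OF p, of \<beta>] by (intro exI[of _ 1]) simp
  next
    case (step t)
    then have t: "1 \<le> t" "t \<le> p" by auto
    obtain c where c: "0 < c" "\<kappa> t - \<rho> * g_of p \<beta> t = c * (1 - \<rho>)" using step by auto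
    have "real t * \<beta> \<le> real p * \<beta>" using t \<beta> by (intro mult_right_mono) auto
    then have d: "0 < 1 - real t * \<beta>" using pos by simp
    have "real (Suc t) * (\<kappa> (Suc t) - \<rho> * g_of p \<beta> (Suc t))
        = real (Suc t) * \<kappa> (Suc t) - \<rho> * (real (Suc t) * g_of p \<beta> (Suc t))"
      by (simp only: right_diff_distrib mult.left_commute)
    also have "\<dots> = (1 - real t * \<beta>) * (\<kappa> t - \<rho> * g_of p \<beta> t)"
      unfolding \<kappa>_Suc[OF t] g_of_Suc[OF t(1) p] Xt[OF t] \<gamma> by (simp add: algebra_simps)
    finally have "\<kappa> (Suc t) - \<rho> * g_of p \<beta> (Suc t) = (1 - real t * \<beta>) * c / real (Suc t) * (1 - \<rho>)"
      unfolding c by (simp add: field_simps)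
    moreover have "0 < (1 - real t * \<beta>) * c / real (Suc t)" using c d by simp
    ultimately show ?case by blast
  qed
  have "\<kappa> (Suc p) - \<rho> * g_of p \<beta> (Suc p) = 0" using gpos by (simp add: \<rho>_def)
  then have "\<rho> = 1" using *[of "Suc p"] p by auto
  then show ?thesis using *[OF r] by auto
qed

text \<open>In \<open>V\<^sub>0\<close> the count is the part size
  \<open>(1 - (p - 1) * \<beta>) * n\<close> minus the degree \<open>(1 - p * \<beta>) * n\<close>;
  elsewhere it is the size of the independent part. A vertex counts as its own
  non-neighbour.\<close>

lemma family_non_nbrs:
  assumes gr: "graph n E" and adm: "admissible n \<beta> E part" and p: "p_of \<beta> = p" and v: "v < n"
  shows "real (card {u. u < n \<and> \<not> E v u}) = \<beta> * real n"
    and "{u. u < n \<and> \<not> E v u} \<subseteq> {u. u < n \<and> part u = part v}"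
proof -
  note ad = adm[unfolded admissible_def Let_def p]
  show sub: "{u. u < n \<and> \<not> E v u} \<subseteq> {u. u < n \<and> part u = part v}"
    using ad v by fastforce
  show "real (card {u. u < n \<and> \<not> E v u}) = \<beta> * real n"
  proof (cases "part v = 0")
    case True
    let ?V = "{u. u < n \<and> part u = 0}"
    have "{u. u < n \<and> \<not> E v u} = ?V - {u\<in>?V. E v u}" using sub True by auto
    then have "card {u. u < n \<and> \<not> E v u} = card ?V - card {u\<in>?V. E v u}"
      by (simp only:) (rule card_Diff_subset, auto)
    moreover have "card {u\<in>?V. E v u} \<le> card ?V" by (rule card_mono) auto
    ultimately have "real (card {u. u < n \<and> \<not> E v u}) = real (card ?V) - real (card {u\<in>?V. E v u})"
      by (simp only: of_nat_diff)
    moreover have "real (card ?V) = (1 - real (p - 1) * \<beta>) * real n" using ad by blast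
    moreover have "real (card {u\<in>?V. E v u}) = (1 - real p * \<beta>) * real n"
      using ad v True by (auto simp: regular_on_def degree_def)
    moreover have "real (p - 1) = real p - 1"
    proof -
      have "0 < p" using ad v by fastforce
      then show ?thesis by (simp add: of_nat_diff)
    qed
    ultimately show ?thesis by (simp only:) (simp add: algebra_simps)
  next
    case False
    have "part v < p" using ad v by blast
    then have pv: "1 \<le> part v \<and> part v \<le> p - 1" using False by simp
    then have "\<forall>u\<in>{w. w < n \<and> part w = part v}. \<forall>w\<in>{w. w < n \<and> part w = part v}. \<not> E u w"
      using ad by blast
    then have "{u. u < n \<and> \<not> E v u} = {u. u < n \<and> part u = part v}"
      using sub v by auto
    then show ?thesis using ad pv by simp
  qed
qed

lemma family_degree:
  assumes "graph n E" "admissible n \<beta> E part" "p_of \<beta> = p" "v < n"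
  shows "real (degree {..<n} E v) = (1 - \<beta>) * real n"
proof -
  have "{..<n} = {u\<in>{..<n}. E v u} \<union> {u. u < n \<and> \<not> E v u}" by auto
  then have "card {..<n} = card ({u\<in>{..<n}. E v u} \<union> {u. u < n \<and> \<not> E v u})" by (simp only:)
  also have "\<dots> = degree {..<n} E v + card {u. u < n \<and> \<not> E v u}"
    unfolding degree_def by (rule card_Un_disjoint) auto
  finally have "real n = real (degree {..<n} E v) + real (card {u. u < n \<and> \<not> E v u})" by simp
  then show ?thesis using family_non_nbrs(1)[OF assms] by (simp add: algebra_simps)
qed

context min_degree_graph
begin

section \<open>Excesses and clique counts of a member whose \<open>V0\<close> spans no
  triangle\<close>

context
  fixes p :: nat and part :: "nat \<Rightarrow> nat" and V0 :: "nat set"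
  assumes adm: "admissible n \<beta> E part" and p: "p_of \<beta> = p" "1 \<le> p"
    and \<beta>: "0 < \<beta>" "real p * \<beta> < 1"
    and V0_def: "V0 = {v. v < n \<and> part v = 0}" and V0_tri: "cliques V0 E 3 = {}"
begin

lemma clique_part_inj:
  assumes S: "S \<in> K t" and uv: "u \<in> S" "v \<in> S" "u \<noteq> v" "part u = part v"
  shows "part u = 0"
proof (rule ccontr)
  note ad = adm[unfolded admissible_def Let_def p]
  note SD = cliquesD[OF S]
  assume nz: "part u \<noteq> 0"
  have n: "u < n" "v < n" using SD(1) uv by auto
  then have "part u < p" using ad by blast
  then have "1 \<le> part u \<and> part u \<le> p - 1" using nz by simp
  then have "\<not> E u v" using ad n uv(4) by auto
  then show False using SD(4) uv by blast
qed

lemma card_clique_V0: "S \<in> K t \<Longrightarrow> card (S \<inter> V0) \<le> 2"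
proof (rule ccontr)
  assume S: "S \<in> K t" and "\<not> card (S \<inter> V0) \<le> 2"
  then have "3 \<le> card (S \<inter> V0)" by simp
  then obtain U where "U \<subseteq> S \<inter> V0" "card U = 3" by (rule obtain_subset_with_card_n)
  then have "U \<in> cliques V0 E 3" using cliquesD(4)[OF S] by (auto simp: cliques_def)
  then show False using V0_tri by simp
qed

text \<open>If \<open>S\<close> has at most one vertex in \<open>V0\<close>, the non-neighbourhoods
  of its vertices are disjoint. Two adjacent vertices of \<open>V0\<close> have no common neighbour
  there, so together they exclude exactly \<open>V0\<close>, whose size is
  \<open>2 * \<beta> * n\<close> minus \<open>((p + 1) * \<beta> - 1) * n\<close>.\<close>

lemma exc_member:
  assumes S: "S \<in> K t"
  shows "x S = (if card (S \<inter> V0) = 2 then (real p + 1) * \<beta> - 1 else 0)"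
proof -
  note SD = cliquesD[OF S]
  let ?N = "\<lambda>v. {u. u < n \<and> \<not> E v u}"
  have finN: "finite (?N v)" for v by (rule finite_subset[of _ "{..<n}"]) auto
  have Ncard: "real (card (?N v)) = \<beta> * real n" and Nsub: "?N v \<subseteq> {u. u < n \<and> part u = part v}"
    if "v \<in> S" for v
    using family_non_nbrs[OF graph adm p(1), of v] that SD(1) by auto
  have union: "real (card (\<Union>v\<in>R. ?N v)) = real (card R) * (\<beta> * real n)"
    if R: "R \<subseteq> S" "card (R \<inter> V0) \<le> 1" for R
  proof -
    have finR: "finite R" using R SD(2) finite_subset by blast
    have disj: "?N u \<inter> ?N v = {}" if uv: "u \<in> R" "v \<in> R" "u \<noteq> v" for u v
    proof -
      have "part u \<noteq> part v"
      proof
        assume eq: "part u = part v"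
        then have "part u = 0" using clique_part_inj[OF S, of u v] uv R by blast
        then have "{u, v} \<subseteq> R \<inter> V0" using eq uv R SD(1) by (auto simp: V0_def)
        then have "card {u, v} \<le> card (R \<inter> V0)" using finR by (intro card_mono) auto
        then show False using R(2) uv(3) by simp
      qed
      moreover have "u \<in> S" "v \<in> S" using uv R(1) by auto
      ultimately show ?thesis using subsetD[OF Nsub[of u]] subsetD[OF Nsub[of v]] by fastforce
    qed
    have "card (\<Union>v\<in>R. ?N v) = (\<Sum>v\<in>R. card (?N v))"
      using disj finN by (intro card_UN_disjoint finR ballI impI) auto
    then have "real (card (\<Union>v\<in>R. ?N v)) = (\<Sum>v\<in>R. real (card (?N v)))" by simp
    also have "\<dots> = (\<Sum>v\<in>R. \<beta> * real n)" using Ncard R by (intro sum.cong) auto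
    finally show ?thesis by simp
  qed
  have nb: "nbrs n E S = {..<n} - (\<Union>v\<in>S. ?N v)" by (auto simp: nbrs_def)
  have sub: "(\<Union>v\<in>S. ?N v) \<subseteq> {..<n}" by auto
  have "card (nbrs n E S) = card {..<n} - card (\<Union>v\<in>S. ?N v)"
    unfolding nb by (rule card_Diff_subset) (use sub finite_subset in auto)
  moreover have "card (\<Union>v\<in>S. ?N v) \<le> card {..<n}" using sub by (intro card_mono) auto
  ultimately have nbc: "real (card (nbrs n E S)) = real n - real (card (\<Union>v\<in>S. ?N v))"
    by (simp add: of_nat_diff)
  show ?thesis
  proof (cases "card (S \<inter> V0) = 2")
    case False
    then have "card (S \<inter> V0) \<le> 1" using card_clique_V0[OF S] by simp
    then have "real (card (nbrs n E S)) = real n - real (card S) * (\<beta> * real n)"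
      using nbc union[of S] by simp
    then have "real (card (nbrs n E S)) / real n = 1 - real (card S) * \<beta>"
      using n_pos by (simp add: field_simps)
    then show ?thesis using False by (simp add: exc_def)
  next
    case True
    then obtain u w where uw: "S \<inter> V0 = {u, w}" "u \<noteq> w" by (auto simp: card_2_iff)
    have uwS: "u \<in> S" "w \<in> S" "u \<in> V0" "w \<in> V0" using uw(1) by auto
    have cov: "?N u \<union> ?N w = V0"
    proof (intro equalityI subsetI)
      fix z assume "z \<in> ?N u \<union> ?N w"
      then show "z \<in> V0" using Nsub[OF uwS(1)] Nsub[OF uwS(2)] uwS by (auto simp: V0_def)
    next
      fix z assume z: "z \<in> V0"
      show "z \<in> ?N u \<union> ?N w"
      proof (rule ccontr)
        assume "z \<notin> ?N u \<union> ?N w"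
        then have zz: "E u z" "E w z" using z by (auto simp: V0_def)
        have e: "E u w" using SD(4) uwS uw(2) by blast
        have "z \<noteq> u" "z \<noteq> w" "E w u" "E z u" "E z w" using zz e graph by (auto simp: graph_def)
        then have "{u, w, z} \<in> cliques V0 E 3"
          using zz e uw(2) uwS z by (auto simp: cliques_def)
        then show False using V0_tri by simp
      qed
    qed
    define R where "R = S - {u, w}"
    have R0: "R \<inter> V0 = {}" using uw(1) by (auto simp: R_def)
    have Rc: "real (card R) = real (card S) - 2"
    proof -
      have "card {u, w} \<le> card S" using uwS SD(2) by (intro card_mono) auto
      moreover have "card R = card S - card {u, w}"
        unfolding R_def using uwS by (intro card_Diff_subset) auto
      ultimately show ?thesis using uw(2) by (simp add: of_nat_diff)
    qed
    have "(\<Union>v\<in>S. ?N v) = V0 \<union> (\<Union>v\<in>R. ?N v)"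
      using cov uwS unfolding R_def by blast
    moreover have "V0 \<inter> (\<Union>v\<in>R. ?N v) = {}"
    proof -
      have "part v \<noteq> 0" if "v \<in> R" for v using that R0 SD(1) by (auto simp: R_def V0_def)
      then show ?thesis using Nsub unfolding R_def V0_def by fastforce
    qed
    moreover have "finite V0" "finite (\<Union>v\<in>R. ?N v)"
      using SD(2) by (auto simp: V0_def R_def)
    ultimately have "card (\<Union>v\<in>S. ?N v) = card V0 + card (\<Union>v\<in>R. ?N v)"
      by (simp only: card_Un_disjoint)
    then have "real (card (\<Union>v\<in>S. ?N v)) = real (card V0) + (real (card S) - 2) * (\<beta> * real n)"
      using union[of R] R0 Rc by (simp add: R_def)
    moreover have "real (card V0) = (1 - (real p - 1) * \<beta>) * real n"
      using adm p unfolding admissible_def Let_def V0_def by (simp add: of_nat_diff)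
    ultimately have "real (card (nbrs n E S)) = real n * (((real p + 1) - real (card S)) * \<beta>)"
      using nbc by (simp add: algebra_simps)
    then have "real (card (nbrs n E S)) / real n = ((real p + 1) - real (card S)) * \<beta>"
      using n_pos by simp
    then show ?thesis using True by (simp add: exc_def algebra_simps)
  qed
qed

text \<open>The equality case of \<open>exc_sum_ge\<close>: if \<open>T\<close> has two vertices in
  \<open>V0\<close>, removing one of them destroys the excess and the other \<open>t - 1\<close>
  removals preserve it.\<close>

lemma exc_sum_member:
  assumes T: "T \<in> K (Suc t)"
  shows "(\<Sum>v\<in>T. x (T - {v})) = (real t - 1) * x T"
proof -
  note TD = cliquesD[OF T]
  let ?\<gamma> = "(real p + 1) * \<beta> - 1"
  have xv: "x (T - {v}) = (if card (T \<inter> V0) = 2 \<and> v \<notin> V0 then ?\<gamma> else 0)" if v: "v \<in> T" for v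
  proof (cases "v \<in> V0")
    case True
    have "(T - {v}) \<inter> V0 = T \<inter> V0 - {v}" by auto
    then have "card ((T - {v}) \<inter> V0) = card (T \<inter> V0) - 1" using True v TD(2) by simp
    then have "card ((T - {v}) \<inter> V0) \<noteq> 2" using card_clique_V0[OF T] by linarith
    then show ?thesis using exc_member[OF clique_remove[OF T v]] True by simp
  next
    case False
    then have "(T - {v}) \<inter> V0 = T \<inter> V0" by auto
    then show ?thesis using exc_member[OF clique_remove[OF T v]] False by simp
  qed
  show ?thesis
  proof (cases "card (T \<inter> V0) = 2")
    case True
    have "(\<Sum>v\<in>T. x (T - {v})) = (\<Sum>v\<in>T. if v \<notin> V0 then ?\<gamma> else 0)"
      using xv True by (intro sum.cong) auto
    also have "\<dots> = real (card (T - V0)) * ?\<gamma>"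
    proof -
      have "T \<inter> {v. v \<notin> V0} = T - V0" by auto
      then show ?thesis using TD(2) by (simp add: sum.If_cases)
    qed
    also have "real (card (T - V0)) = real t - 1"
    proof -
      have "card T = card (T \<inter> V0) + card (T - V0)"
        using TD(2) by (metis Int_Diff_disjoint Int_Diff_Un card_Un_disjoint finite_Diff finite_Int)
      then show ?thesis using True TD(3) by linarith
    qed
    finally show ?thesis using exc_member[OF T] True by simp
  next
    case False
    then have "(\<Sum>v\<in>T. x (T - {v})) = (\<Sum>v\<in>T. 0)" using xv by (intro sum.cong) auto
    then show ?thesis using exc_member[OF T] False by simp
  qed
qed

lemma kappa_member:
  assumes r: "1 \<le> r" "r \<le> Suc p"
  shows "\<kappa> r = g_of p \<beta> r"
proof (rule recursion_solution[where X = "avg x" and \<kappa> = \<kappa>, OF p(2) \<beta>(1) refl \<beta>(2) kappa_1 kappa_Suc _ _ _ r])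
  let ?\<gamma> = "(real p + 1) * \<beta> - 1"
  have "avg x 1 = avg (\<lambda>_. 0 * 1) 1"
  proof (rule avg_cong)
    fix S assume S: "S \<in> K 1"
    have "card (S \<inter> V0) \<le> card S" using cliquesD(2)[OF S] by (intro card_mono) auto
    then have "card (S \<inter> V0) \<noteq> 2" using cliquesD(3)[OF S] by simp
    then show "x S = 0 * 1" using exc_member[OF S] by simp
  qed
  then show "avg x 1 = 0" by (simp only: avg_cmult)
  show "(real t - 1) * avg x (Suc t) = (real p + 1 - real t) * \<beta> * avg x t" for t
  proof -
    have "(real t - 1) * avg x (Suc t) = avg (\<lambda>T. (real t - 1) * x T) (Suc t)"
      by (rule avg_cmult[symmetric])
    also have "\<dots> = avg (\<lambda>T. \<Sum>v\<in>T. x (T - {v})) (Suc t)"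
      by (rule avg_cong) (rule exc_sum_member[symmetric])
    also have "\<dots> = avg (\<lambda>S. (1 - real t * \<beta> + x S) * x S) t" by (rule avg_shift)
    \<comment> \<open>Each \<open>x S\<close> is 0 or \<open>(p + 1) * \<beta> - 1\<close>, so its
      square is \<open>(p + 1) * \<beta> - 1\<close> times \<open>x S\<close>.\<close>
    also have "\<dots> = avg (\<lambda>S. (real p + 1 - real t) * \<beta> * x S) t"
      by (rule avg_cong) (auto simp: exc_member algebra_simps)
    finally show ?thesis by (simp only: avg_cmult)
  qed
  have "avg x (Suc p) = avg (\<lambda>_. ?\<gamma> * 1) (Suc p)"
  proof (rule avg_cong)
    fix T assume T: "T \<in> K (Suc p)"
    note TD = cliquesD[OF T]
    \<comment> \<open>The other \<open>p - 1\<close> parts hold at most one vertex of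
      \<open>T\<close> each, so a \<open>(p + 1)\<close>-clique has exactly two vertices in
      \<open>V0\<close>.\<close>
    have "inj_on part (T - V0)"
      using clique_part_inj[OF T] TD(1) by (auto simp: inj_on_def V0_def)
    moreover have "part ` (T - V0) \<subseteq> {1..<p}"
    proof
      fix k assume "k \<in> part ` (T - V0)"
      then obtain v where v: "v \<in> T" "v \<notin> V0" "k = part v" by blast
      then have "v < n" using TD(1) by auto
      then have "part v < p" using adm p unfolding admissible_def Let_def by blast
      then show "k \<in> {1..<p}" using v \<open>v < n\<close> by (auto simp: V0_def)
    qed
    ultimately have "card (T - V0) \<le> p - 1"
      using card_inj_on_le[of part "T - V0" "{1..<p}"] by simp
    moreover have "card T = card (T \<inter> V0) + card (T - V0)"
      using TD(2) by (metis Int_Diff_disjoint Int_Diff_Un card_Un_disjoint finite_Diff finite_Int)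
    ultimately have "card (T \<inter> V0) = 2"
      using card_clique_V0[OF T] TD(3) p by simp
    then show "x T = ?\<gamma> * 1" using exc_member[OF T] by simp
  qed
  then show "avg x (Suc p) = ?\<gamma> * \<kappa> (Suc p)" by (simp only: avg_cmult)
qed

end

end

section \<open>Structure and existence\<close>

lemma card_non_nbrs:
  assumes "v < n" "degree {..<n} E v = n - b" "b \<le> n"
  shows "card {u. u < n \<and> \<not> E v u} = b"
proof -
  have "{u. u < n \<and> \<not> E v u} = {..<n} - {u\<in>{..<n}. E v u}" by auto
  then have "card {u. u < n \<and> \<not> E v u} = card {..<n} - card {u\<in>{..<n}. E v u}"
    by (simp only:) (rule card_Diff_subset, auto)
  then have "card {u. u < n \<and> \<not> E v u} = n - degree {..<n} E v" by (simp add: degree_def)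
  then show ?thesis using assms by simp
qed

text \<open>For \<open>i\<close> in \<open>I\<close> the common neighbourhood \<open>M i\<close> of
  \<open>T - {i}\<close> becomes a part, and the vertices outside all of these form
  \<open>V0\<close>. The adjacencies follow from the absence of \<open>(p + 2)\<close>-cliques and
  from comparing sizes with \<open>b\<close>.\<close>

lemma family_from_clique:
  assumes gr: "graph n E" and reg: "\<And>v. v < n \<Longrightarrow> degree {..<n} E v = n - b" and bn: "b \<le> n"
    and b: "real b = \<beta> * real n" and p: "p_of \<beta> = p" "1 \<le> p"
    and noK: "cliques {..<n} E (p + 2) = {}"
    and T: "T \<in> cliques {..<n} E (Suc p)" and I: "I \<subseteq> T" "card I = p - 1"
    and N: "\<And>i. i \<in> I \<Longrightarrow> card (nbrs n E (T - {i})) = b"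
  shows "\<exists>part. admissible n \<beta> E part \<and> cliques {v. v < n \<and> part v = 0} E 3 = {}"
proof -
  note TD = cliquesD[OF T]
  have sym: "E u v \<Longrightarrow> E v u" and irr: "\<not> E v v" and lt: "E u v \<Longrightarrow> u < n \<and> v < n" for u v
    using gr by (auto simp: graph_def)
  have finI: "finite I" using I TD(2) finite_subset by blast
  define M where "M = (\<lambda>i. nbrs n E (T - {i}))"
  \<comment> \<open>A neighbour of \<open>i\<close> in \<open>M i\<close> would extend
    \<open>T\<close> to a \<open>(p + 2)\<close>-clique; both sets have \<open>b\<close> elements,
    so the inclusion is an equality.\<close>
  have M_non: "M i = {u. u < n \<and> \<not> E i u}" if i: "i \<in> I" for i
  proof (rule card_subset_eq)
    have iT: "i \<in> T" "i < n" using i I TD(1) by auto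
    show "M i \<subseteq> {u. u < n \<and> \<not> E i u}"
    proof safe
      fix u assume u: "u \<in> M i"
      then show "u < n" by (simp add: M_def nbrs_def)
      assume "E i u"
      then have "u \<in> nbrs n E T" using u by (auto simp: M_def nbrs_def)
      then show False using clique_insert(1)[OF gr T] noK by auto
    qed
    show "card (M i) = card {u. u < n \<and> \<not> E i u}"
      using N[OF i] card_non_nbrs[OF iT(2) reg[OF iT(2)] bn] by (simp add: M_def)
  qed auto
  \<comment> \<open>An edge inside \<open>M i\<close> together with \<open>T - {i}\<close> would
    form a \<open>(p + 2)\<close>-clique.\<close>
  have M_indep: "\<not> E u w" if i: "i \<in> I" and u: "u \<in> M i" "w \<in> M i" for i u w
  proof
    assume e: "E u w"
    have S: "T - {i} \<in> cliques {..<n} E p" using clique_remove[OF T] i I by auto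
    have S': "insert u (T - {i}) \<in> cliques {..<n} E (Suc p)"
      using clique_insert(1)[OF gr S] u by (simp add: M_def)
    have "w \<in> nbrs n E (insert u (T - {i}))" using u e by (auto simp: M_def nbrs_def)
    then show False using clique_insert(1)[OF gr S'] noK by auto
  qed
  have M_cross: "E u w" if i: "i \<in> I" and u: "u \<in> M i" "w < n" "w \<notin> M i" for i u w
  proof -
    have un: "u < n" using u by (simp add: M_def nbrs_def)
    \<comment> \<open>\<open>M i\<close> is independent and as large as the non-neighbourhood of
      \<open>u\<close>, so \<open>u\<close> is joined to everything outside it.\<close>
    have "M i = {w. w < n \<and> \<not> E u w}"
    proof (rule card_subset_eq)
      show "M i \<subseteq> {w. w < n \<and> \<not> E u w}" using M_indep[OF i u(1)] by (auto simp: M_def nbrs_def)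
      show "card (M i) = card {w. w < n \<and> \<not> E u w}"
        using N[OF i] card_non_nbrs[OF un reg[OF un] bn] by (simp add: M_def)
    qed auto
    then show ?thesis using u by blast
  qed
  have M_disj: "M i \<inter> M j = {}" if "i \<in> I" "j \<in> I" "i \<noteq> j" for i j
  proof -
    have "E i u" if "u \<in> M j" for u
      using that \<open>i \<in> I\<close> \<open>i \<noteq> j\<close> I by (auto simp: M_def nbrs_def)
    then show ?thesis using M_non[OF that(1)] by blast
  qed
  obtain h where h: "bij_betw h I {1..p - 1}"
    using finite_same_card_bij[OF finI, of "{1..p - 1}"] I by auto
  \<comment> \<open>\<open>h\<close> numbers the sets \<open>M i\<close> from 1; the default value 0
    collects the remaining vertices in \<open>V0\<close>.\<close>
  define part where "part = (\<lambda>v. if \<exists>i\<in>I. v \<in> M i then h (THE i. i \<in> I \<and> v \<in> M i) else 0)"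
  have part_M: "part v = h i" if "i \<in> I" "v \<in> M i" for i v
  proof -
    have "(THE i. i \<in> I \<and> v \<in> M i) = i" using that M_disj by blast
    then show ?thesis using that by (auto simp: part_def)
  qed
  have h1: "1 \<le> h i" "h i \<le> p - 1" if "i \<in> I" for i
    using bij_betwE[OF h] that by fastforce+
  have part_0: "part v = 0 \<longleftrightarrow> (\<forall>i\<in>I. v \<notin> M i)" for v
  proof
    show "\<forall>i\<in>I. v \<notin> M i" if "part v = 0" using that part_M h1(1) by fastforce
  qed (simp add: part_def)
  have part_eq: "{v. v < n \<and> part v = h i} = M i" if i: "i \<in> I" for i
  proof (intro equalityI subsetI)
    fix v assume v: "v \<in> {v. v < n \<and> part v = h i}"
    then have "part v \<noteq> 0" using h1[OF i] by simp
    then obtain j where j: "j \<in> I" "v \<in> M j" using part_0 by metis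
    then have "h i = h j" using part_M v by simp
    then have "i = j" using h i j by (auto simp: bij_betw_def inj_on_def)
    then show "v \<in> M i" using j by simp
  next
    fix v assume "v \<in> M i"
    then show "v \<in> {v. v < n \<and> part v = h i}" using part_M[OF i] by (auto simp: M_def nbrs_def)
  qed
  have h_onto: "\<exists>i\<in>I. k = h i" if "1 \<le> k" "k \<le> p - 1" for k
    using h that by (auto simp: bij_betw_def image_iff)
  define V0 where "V0 = {v. v < n \<and> part v = 0}"
  define U where "U = (\<Union>i\<in>I. M i)"
  have U_card: "card U = (p - 1) * b"
  proof -
    have "card U = (\<Sum>i\<in>I. card (M i))"
      unfolding U_def using finI M_disj by (intro card_UN_disjoint) (auto simp: M_def)
    then show ?thesis using N I by (simp add: M_def)
  qed
  have U_sub: "U \<subseteq> {..<n}" by (auto simp: U_def M_def nbrs_def)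
  have V0: "V0 = {..<n} - U" by (auto simp: V0_def part_0 U_def)
  have Un: "(p - 1) * b \<le> n" using card_mono[OF _ U_sub] U_card by simp
  have V0_card: "card V0 = n - (p - 1) * b"
    unfolding V0 using U_sub U_card finite_subset[OF U_sub] by (simp add: card_Diff_subset)
  have V0_U: "E u w" if uw: "u \<in> V0" "w \<in> U" for u w
  proof -
    obtain i where "i \<in> I" "w \<in> M i" using uw(2) by (auto simp: U_def)
    then show ?thesis using uw(1) M_cross[of i w u] sym by (auto simp: V0_def part_0)
  qed
  have V0_deg: "real (degree V0 E v) = (1 - real p * \<beta>) * real n" if v: "v \<in> V0" for v
  proof -
    have vn: "v < n" using v by (simp add: V0_def)
    have "{u\<in>{..<n}. E v u} = {u\<in>V0. E v u} \<union> U"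
      using V0_U[OF v] U_sub by (auto simp: V0)
    moreover have "card ({u\<in>V0. E v u} \<union> U) = card {u\<in>V0. E v u} + card U"
      using finite_subset[OF U_sub] by (intro card_Un_disjoint) (auto simp: V0)
    ultimately have "n - b = degree V0 E v + (p - 1) * b"
      using reg[OF vn] U_card by (simp add: degree_def)
    then have "real (n - b) = real (degree V0 E v + (p - 1) * b)" by (simp only:)
    then have "real n - real b = real (degree V0 E v) + (real p - 1) * real b"
      using bn p by (simp add: of_nat_diff)
    then show ?thesis using b by (simp add: algebra_simps)
  qed
  \<comment> \<open>A triangle in \<open>V0\<close> is joined to all \<open>p - 1\<close> vertices
    of \<open>I\<close> and would complete them to a \<open>(p + 2)\<close>-clique.\<close>
  have V0_tri: "cliques V0 E 3 = {}"
  proof (rule equals0I)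
    fix S assume S: "S \<in> cliques V0 E 3"
    then have SD: "S \<subseteq> V0" "card S = 3" "\<And>u v. u \<in> S \<Longrightarrow> v \<in> S \<Longrightarrow> u \<noteq> v \<Longrightarrow> E u v"
      by (auto simp: cliques_def)
    have finS: "finite S" using SD(2) by (metis card.infinite zero_neq_numeral)
    have adj: "E u i" if "u \<in> S" "i \<in> I" for u i
    proof -
      have "u < n" "u \<notin> M i" using that SD(1) by (auto simp: V0_def part_0)
      then show ?thesis using M_non[OF that(2)] sym by blast
    qed
    have disj: "S \<inter> I = {}" using adj irr by blast
    have "card (S \<union> I) = p + 2"
      using card_Un_disjoint[OF finS finI disj] SD(2) I p by simp
    moreover have "S \<union> I \<subseteq> {..<n}" using SD(1) I TD(1) by (auto simp: V0_def)
    moreover have "E u v" if "u \<in> S \<union> I" "v \<in> S \<union> I" "u \<noteq> v" for u v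
      using that SD(3) adj sym TD(4) I by blast
    ultimately have "S \<union> I \<in> cliques {..<n} E (p + 2)" by (auto simp: cliques_def)
    then show False using noK by simp
  qed
  have pm: "part v < p" for v
  proof (cases "part v = 0")
    case False
    then obtain i where "i \<in> I" "v \<in> M i" using part_0 by metis
    then show ?thesis using part_M h1[of i] p by fastforce
  qed (use p in simp)
  have cross: "E u v" if "u < n" "v < n" "part u \<noteq> part v" for u v
  proof -
    have *: "E u v" if uv: "u < n" "v < n" "part u \<noteq> part v" "part u \<noteq> 0" for u v
    proof -
      obtain i where i: "i \<in> I" "u \<in> M i" using uv part_0 by metis
      then have "v \<notin> M i" using part_M uv by metis
      then show ?thesis using M_cross i uv by blast
    qed
    show ?thesis
    proof (cases "part u = 0")
      case True
      then show ?thesis using *[of v u] that sym by auto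
    qed (use * that in blast)
  qed
  have "admissible n \<beta> E part"
    unfolding admissible_def Let_def p(1)
  proof (intro conjI allI impI ballI)
    show "real (card {v. v < n \<and> part v = 0}) = (1 - real (p - 1) * \<beta>) * real n"
    proof -
      have "real (card V0) = real n - real (p - 1) * real b"
        unfolding V0_card using Un by (simp only: of_nat_diff of_nat_mult)
      then show ?thesis unfolding V0_def[symmetric] b by (simp add: algebra_simps)
    qed
    show "regular_on {v. v < n \<and> part v = 0} E ((1 - real p * \<beta>) * real n)"
      unfolding regular_on_def V0_def[symmetric] using V0_deg by blast
    show "card (cliques {v. v < n \<and> part v = 0} E 3) \<le> kr (card {v. v < n \<and> part v = 0}) H 3" for H
      unfolding V0_def[symmetric] V0_tri by simp
    fix k assume k: "1 \<le> k \<and> k \<le> p - 1"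
    then obtain i where i: "i \<in> I" "k = h i" using h_onto by blast
    show "real (card {v. v < n \<and> part v = k}) = \<beta> * real n"
      unfolding i(2) part_eq[OF i(1)] using N[OF i(1)] b by (simp add: M_def)
    fix u v assume "u \<in> {v. v < n \<and> part v = k}" "v \<in> {v. v < n \<and> part v = k}"
    then show "\<not> E u v" unfolding i(2) part_eq[OF i(1)] using M_indep[OF i(1)] by blast
  qed (use pm cross in auto)
  then show ?thesis using V0_tri unfolding V0_def by blast
qed

section \<open>Regular circulant graphs, and graphs of prescribed minimum degree\<close>

lemma exists_regular_graph:
  assumes "d < m" "even (m * d)"
  shows "\<exists>H. graph m H \<and> (\<forall>v<m. degree {..<m} H v = d)"
proof -
  define k where "k = d div 2"
  \<comment> \<open>The connection set of a circulant graph: \<open>k\<close> residues on either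
    side of 0, and for odd \<open>d\<close> also the antipode \<open>m div 2\<close>, where
    \<open>m\<close> is even.\<close>
  define C where "C = {1..k} \<union> {m - k..<m} \<union> (if odd d then {m div 2} else {})"
  have km: "2 * k < m" using assms(1) by (auto simp: k_def)
  have odd: "m = 2 * (m div 2) \<and> k < m div 2" if "odd d"
  proof -
    have "even m" using assms(2) that by simp
    moreover have "2 * k + 1 = d" using that by (simp add: k_def)
    ultimately show ?thesis using assms(1) by (auto elim!: evenE)
  qed
  have C: "C \<subseteq> {1..<m}" using km odd by (auto simp: C_def)
  have C_sym: "m - c \<in> C" if "c \<in> C" for c
  proof -
    have "c \<in> {1..k} \<or> c \<in> {m - k..<m} \<or> odd d \<and> c = m div 2"
      using that by (auto simp: C_def split: if_splits)
    then consider "c \<in> {1..k}" | "c \<in> {m - k..<m}" | "odd d" "c = m div 2" by blast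
    then show ?thesis
    proof cases
      case 1 then show ?thesis using km by (auto simp: C_def)
    next
      case 2 then show ?thesis using km by (auto simp: C_def)
    next
      case 3
      then have "m - c = m div 2" using odd by linarith
      then show ?thesis using 3 by (simp add: C_def)
    qed
  qed
  have C_card: "card C = d"
  proof -
    have 1: "card ({1..k} \<union> {m - k..<m}) = 2 * k"
      using km by (subst card_Un_disjoint) auto
    show ?thesis
    proof (cases "odd d")
      case True
      then have "m div 2 \<notin> {1..k} \<union> {m - k..<m}" using odd by auto
      then have "card C = Suc (2 * k)" using True 1 by (simp add: C_def)
      then show ?thesis using True by (simp add: k_def)
    next
      case False
      then show ?thesis using 1 by (simp add: C_def k_def)
    qed
  qed
  \<comment> \<open>For \<open>u\<close> and \<open>v\<close> below \<open>m\<close> this is the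
    residue of \<open>v - u\<close> modulo \<open>m\<close>.\<close>
  define f where "f = (\<lambda>u v. if u \<le> v then v - u else v + m - u)"
  define H where "H = (\<lambda>u v. u < m \<and> v < m \<and> f u v \<in> C)"
  have sym: "H v u" if "H u v" for u v
  proof -
    have "f u v \<noteq> 0" using that C by (auto simp: H_def)
    moreover have "u < m" "v < m" using that by (auto simp: H_def)
    ultimately have "f v u = m - f u v" by (auto simp: f_def)
    then show ?thesis using that C_sym by (simp add: H_def)
  qed
  have "graph m H"
    unfolding graph_def using sym C by (auto simp: H_def f_def)
  moreover have "degree {..<m} H u = d" if u: "u < m" for u
  proof -
    have inj: "inj_on (f u) {..<m}" using u by (auto simp: inj_on_def f_def split: if_splits)
    have "f u ` {..<m} \<subseteq> {..<m}" using u by (auto simp: f_def)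
    then have surj: "f u ` {..<m} = {..<m}" using endo_inj_surj[OF _ _ inj] by simp
    have "f u ` {v\<in>{..<m}. H u v} = C"
    proof (intro equalityI subsetI)
      fix c assume c: "c \<in> C"
      then have "c \<in> f u ` {..<m}" using C surj by auto
      then show "c \<in> f u ` {v\<in>{..<m}. H u v}" using c u by (auto simp: H_def)
    qed (auto simp: H_def)
    moreover have "inj_on (f u) {v\<in>{..<m}. H u v}" using inj by (rule inj_on_subset) auto
    ultimately show ?thesis unfolding degree_def using C_card card_image by fastforce
  qed
  ultimately show ?thesis by blast
qed

text \<open>In a complete graph, vertex 0 keeps only its edges to the vertices from 1 to
  \<open>\<delta>\<close>. Hence \<open>kmin\<close> is a minimum over a nonempty set.\<close>

lemma exists_mindeg:
  assumes "\<delta> < n"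
  shows "\<exists>E. graph n E \<and> mindeg n E = \<delta>"
proof -
  define E where "E = (\<lambda>u v. u < n \<and> v < n \<and> u \<noteq> v \<and> (u = 0 \<longrightarrow> v \<le> \<delta>) \<and> (v = 0 \<longrightarrow> u \<le> \<delta>))"
  have "graph n E" by (auto simp: graph_def E_def)
  moreover have "mindeg n E = \<delta>"
    unfolding mindeg_def
  proof (rule Min_eqI)
    have "{u\<in>{..<n}. E 0 u} = {1..\<delta>}" using assms by (auto simp: E_def)
    then have "degree {..<n} E 0 = \<delta>" by (simp add: degree_def)
    then show "\<delta> \<in> degree {..<n} E ` {..<n}" using assms by force
  next
    fix d assume "d \<in> degree {..<n} E ` {..<n}"
    then obtain v where v: "v < n" "d = card {u\<in>{..<n}. E v u}" by (auto simp: degree_def)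
    show "\<delta> \<le> d"
    proof (cases "v \<le> \<delta>")
      case True
      have "{0..\<delta>} - {v} \<subseteq> {u\<in>{..<n}. E v u}" using True assms v(1) by (auto simp: E_def)
      then have "card ({0..\<delta>} - {v}) \<le> d" unfolding v(2) by (intro card_mono) auto
      then show ?thesis using True by simp
    next
      case False
      have "{1..\<delta>} \<subseteq> {u\<in>{..<n}. E v u}" using False assms v(1) by (auto simp: E_def)
      then have "card {1..\<delta>} \<le> d" unfolding v(2) by (intro card_mono) auto
      then show ?thesis by simp
    qed
  qed simp
  ultimately show ?thesis by blast
qed

lemma mindeg_le: "v < n \<Longrightarrow> mindeg n E \<le> degree {..<n} E v"
  unfolding mindeg_def by (rule Min_le) auto

lemma mindeg_regular: "0 < n \<Longrightarrow> (\<And>v. v < n \<Longrightarrow> degree {..<n} E v = d) \<Longrightarrow> mindeg n E = d"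
  unfolding mindeg_def by (rule Min_eqI) force+

lemma kr_le: "kr n E r \<le> 2 ^ n"
proof -
  have "kr n E r \<le> card (Pow {..<n})"
    unfolding kr_def by (rule card_mono) (auto simp: cliques_def)
  then show ?thesis by (simp add: card_Pow)
qed

lemma kmin_props:
  assumes "\<delta> < n"
  shows "\<exists>E. graph n E \<and> mindeg n E = \<delta> \<and> kr n E r = kmin n \<delta> r"
    and "\<And>E. graph n E \<Longrightarrow> mindeg n E = \<delta> \<Longrightarrow> kmin n \<delta> r \<le> kr n E r"
proof -
  let ?A = "{kr n E r | E. graph n E \<and> mindeg n E = \<delta>}"
  have fin: "finite ?A" by (rule finite_subset[of _ "{..2 ^ n}"]) (auto simp: kr_le)
  have ne: "?A \<noteq> {}" using exists_mindeg[OF assms] by auto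
  show "\<exists>E. graph n E \<and> mindeg n E = \<delta> \<and> kr n E r = kmin n \<delta> r"
    using Min_in[OF fin ne] unfolding kmin_def by force
  show "kmin n \<delta> r \<le> kr n E r" if "graph n E" "mindeg n E = \<delta>" for E
    unfolding kmin_def using that by (intro Min_le[OF fin]) auto
qed

lemma p_of_eq:
  assumes "1 / (real p + 1) \<le> \<beta>" "real p * \<beta> < 1"
  shows "p_of \<beta> = p"
proof -
  have "0 < 1 / (real p + 1)" by simp
  then have b: "0 < \<beta>" using assms(1) by linarith
  have "\<lceil>1 / \<beta>\<rceil> = int p + 1"
    by (rule ceiling_unique) (use assms b in \<open>simp_all add: field_simps\<close>)
  then show ?thesis by (simp add: p_of_def)
qed

lemma min_degree_graphI:
  assumes "graph n E" "mindeg n E = \<delta>" "0 < n" "(1 - \<beta>) * real n = real \<delta>"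
  shows "min_degree_graph n E \<beta>"
  by unfold_locales (use assms mindeg_le[of _ n E] in auto)

text \<open>The case \<open>p = 1\<close>, which lies outside \<open>near_turan\<close>. Size 2
  follows from \<open>kappa_Suc\<close>, and \<open>g_of\<close> vanishes from size 3 on.\<close>

lemma (in min_degree_graph) g_of_1_le_kappa:
  assumes "1 \<le> r"
  shows "g_of 1 \<beta> r \<le> \<kappa> r"
proof -
  have "r = 1 \<or> r = 2 \<or> 3 \<le> r" using assms by arith
  then consider "r = 1" | "r = 2" | "3 \<le> r" by blast
  then show ?thesis
  proof cases
    case 1
    then show ?thesis using kappa_1 by (simp add: g_of_1 del: One_nat_def)
  next
    case 2
    have "real (Suc 1) * g_of 1 \<beta> (Suc 1) \<le> real (Suc 1) * \<kappa> (Suc 1)"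
      using g_of_Suc[of 1 1 \<beta>] kappa_Suc[of 1] avg_exc_nonneg[of 1] kappa_1 g_of_1[of 1 \<beta>]
      by (simp add: g_edge_def del: One_nat_def)
    then have "g_of 1 \<beta> (Suc 1) \<le> \<kappa> (Suc 1)" by simp
    then show ?thesis using 2 by (simp only: Suc_1)
  next
    case 3
    then show ?thesis using g_of_0[of 1 r] avg_nonneg[of r "\<lambda>_. 1"] by simp
  qed
qed

lemma (in near_turan) tight_admissible:
  assumes b: "real b = \<beta> * real n" and r: "3 \<le> r" "r \<le> Suc p" "\<kappa> r = g_of p \<beta> r"
  shows "\<exists>part. admissible n \<beta> E part \<and> cliques {v. v < n \<and> part v = 0} E 3 = {}"
proof -
  note tight = kappa_eqD[OF r]
  have pb: "real p * \<beta> < 1" using density_pos[of p] by simp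
  have pof: "p_of \<beta> = p" by (rule p_of_eq[OF \<beta>_ge pb])
  have "1 * \<beta> \<le> real p * \<beta>" using p2 \<beta>_pos by (intro mult_right_mono) auto
  then have "\<beta> \<le> 1" using pb by simp
  then have bn: "b \<le> n"
    using b mult_right_mono[of \<beta> 1 "real n"] by simp
  have deg: "degree {..<n} E v = n - b" if "v < n" for v
  proof -
    have "real (degree {..<n} E v) = real (n - b)"
      using tight(1)[OF that] b bn by (simp add: of_nat_diff algebra_simps)
    then show ?thesis by simp
  qed
  obtain T where T: "T \<in> K (Suc p)" using tight(3) by blast
  note TD = cliquesD[OF T]
  define J where "J = {v\<in>T. x (T - {v}) = \<gamma>}"
  have xT: "x (T - {v}) = 0 \<or> x (T - {v}) = \<gamma>" if "v \<in> T" for v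
    using tight(4) clique_remove[OF T that] by blast
  \<comment> \<open>\<open>x T\<close> is at least \<open>\<gamma>\<close>, so by
    \<open>exc_sum_ge\<close> at least \<open>p - 1\<close> of the cliques \<open>T - {v}\<close>
    have excess \<open>\<gamma>\<close>; for \<open>\<gamma> = 0\<close> all of them do.\<close>
  have "p - 1 \<le> card J"
  proof (cases "\<gamma> = 0")
    case True
    then have "J = T" using xT by (auto simp: J_def)
    then show ?thesis using TD(3) by simp
  next
    case False
    then have g: "0 < \<gamma>" using \<gamma>_nonneg by simp
    have "(real p - 1) * \<gamma> \<le> (real p - 1) * x T"
      using exc_top[OF T] p2 by (intro mult_left_mono) auto
    also have "\<dots> \<le> (\<Sum>v\<in>T. x (T - {v}))" by (rule exc_sum_ge[OF T])
    also have "\<dots> = (\<Sum>v\<in>T. if x (T - {v}) = \<gamma> then \<gamma> else 0)"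
      using xT by (intro sum.cong) auto
    also have "\<dots> = real (card J) * \<gamma>"
    proof -
      have "T \<inter> {v. x (T - {v}) = \<gamma>} = J" by (auto simp: J_def)
      then show ?thesis using TD(2) by (simp add: sum.If_cases)
    qed
    finally have "real p - 1 \<le> real (card J)" using g by (simp only: mult_le_cancel_right_pos)
    then show ?thesis by linarith
  qed
  then obtain I where I: "I \<subseteq> J" "card I = p - 1" by (rule obtain_subset_with_card_n)
  show ?thesis
  proof (rule family_from_clique[OF graph deg bn b pof _ tight(2) T])
    show "1 \<le> p" using p2 by simp
    show "I \<subseteq> T" "card I = p - 1" using I by (auto simp: J_def)
    \<comment> \<open>Excess \<open>\<gamma>\<close> at size \<open>p\<close> means density
      \<open>1 - p * \<beta> + \<gamma> = \<beta>\<close>, that is, \<open>b\<close> common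
      neighbours.\<close>
    show "card (nbrs n E (T - {i})) = b" if "i \<in> I" for i
    proof -
      have i: "i \<in> T" "x (T - {i}) = \<gamma>" using that I by (auto simp: J_def)
      have "card (T - {i}) = p" using cliquesD(3)[OF clique_remove[OF T i(1)]] .
      then have "real (card (nbrs n E (T - {i}))) = real b"
        using card_nbrs_eq[of "T - {i}" p] i(2) b by (simp add: algebra_simps)
      then show ?thesis by simp
    qed
  qed
qed

section \<open>Feasibility, and members of the family for given parameters\<close>

lemma transport_regular:
  assumes gr: "graph n E" and V: "V \<subseteq> {..<n}" and reg: "regular_on V E d" and tri: "cliques V E 3 = {}"
  shows "\<exists>H. graph (card V) H \<and> regular_on {..<card V} H d \<and> kr (card V) H 3 = 0"
proof -
  have finV: "finite V" using V finite_subset by blast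
  obtain h where h: "bij_betw h {..<card V} V"
    using finite_same_card_bij[of "{..<card V}" V] finV by auto
  define H where "H = (\<lambda>i j. i < card V \<and> j < card V \<and> E (h i) (h j))"
  have hV: "h i \<in> V" if "i < card V" for i using h that by (auto simp: bij_betw_def)
  have "graph (card V) H" using gr by (auto simp: graph_def H_def)
  moreover have "regular_on {..<card V} H d"
    unfolding regular_on_def
  proof
    fix i assume "i \<in> {..<card V}"
    then have i: "i < card V" by simp
    have "h ` {j\<in>{..<card V}. H i j} = {u\<in>V. E (h i) u}"
      using h i by (fastforce simp: bij_betw_def H_def)
    moreover have "inj_on h {j\<in>{..<card V}. H i j}"
      using h by (auto simp: bij_betw_def inj_on_def)
    ultimately have "degree {..<card V} H i = degree V E (h i)"
      unfolding degree_def using card_image by fastforce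
    then show "real (degree {..<card V} H i) = d" using reg hV[OF i] by (simp add: regular_on_def)
  qed
  moreover have "kr (card V) H 3 = 0"
  proof -
    have "cliques {..<card V} H 3 = {}"
    proof (rule equals0I)
      fix S assume S: "S \<in> cliques {..<card V} H 3"
      note SD = cliquesD[OF S]
      have inj: "inj_on h S" using h SD(1) by (auto simp: bij_betw_def intro: inj_on_subset)
      have "h ` S \<subseteq> V" using SD(1) hV by auto
      moreover have "E u v" if "u \<in> h ` S" "v \<in> h ` S" "u \<noteq> v" for u v
        using that SD(4) by (auto simp: H_def)
      ultimately have "h ` S \<in> cliques V E 3"
        using card_image[OF inj] SD(3) by (simp add: cliques_def)
      then show False using tri by simp
    qed
    then show ?thesis by (simp add: kr_def)
  qed
  ultimately show ?thesis by blast
qed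

text \<open>The degree sum is twice the number of edges; this supplies the parity condition in
  \<open>family_defined\<close>.\<close>

lemma regular_handshake:
  assumes "graph n E" "\<And>v. v < n \<Longrightarrow> degree {..<n} E v = d"
  shows "even (n * d)"
proof -
  have "(\<Sum>S\<in>cliques {..<n} E 1. real (card (nbrs n E S))) = (\<Sum>v<n. real (card (nbrs n E {v})))"
    unfolding cliques_1 by (subst sum.reindex) auto
  also have "\<dots> = real (n * d)" using assms(2) by (simp add: card_nbrs_singleton)
  finally have "real (2 * kr n E 2) = real (n * d)"
    using kr_Suc[OF assms(1), of 1] by (simp add: numeral_2_eq_2)
  then have "n * d = 2 * kr n E 2" by linarith
  then show ?thesis by simp
qed

text \<open>One member with triangle-free \<open>V\<^sub>0\<close> suffices: it is a competitor in
  the minimality clause of every other member, which forces their triangle counts to be 0.\<close>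

lemma feasibleI:
  assumes gr: "graph n E" and adm: "admissible n \<beta> E part"
    and tri: "cliques {v. v < n \<and> part v = 0} E 3 = {}"
    and n: "0 < n" and \<beta>: "0 < \<beta>" "\<beta> < 1" and \<delta>: "0 < \<delta>" "real \<delta> = (1 - \<beta>) * real n"
  shows "feasible n \<beta>"
proof -
  let ?p = "p_of \<beta>"
  let ?V = "{v. v < n \<and> part v = 0}"
  have "degree {..<n} E v = \<delta>" if "v < n" for v
  proof -
    have "real (degree {..<n} E v) = real \<delta>" using family_degree[OF gr adm refl that] \<delta>(2) by simp
    then show ?thesis by (simp only: of_nat_eq_iff)
  qed
  then have "even (n * \<delta>)" by (rule regular_handshake[OF gr])
  then have fd: "family_defined n \<beta>"
    unfolding family_defined_def using n \<beta> \<delta> by auto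
  have reg: "regular_on ?V E ((1 - real ?p * \<beta>) * real n)"
    and cV: "real (card ?V) = (1 - real (?p - 1) * \<beta>) * real n"
    using adm unfolding admissible_def Let_def by blast+
  have Vn: "?V \<subseteq> {..<n}" by auto
  \<comment> \<open>Competitors in the minimality clause live on an initial segment, so the graph on
    \<open>?V\<close> is relabelled.\<close>
  obtain H where H: "graph (card ?V) H" "regular_on {..<card ?V} H ((1 - real ?p * \<beta>) * real n)"
      "kr (card ?V) H 3 = 0"
    using transport_regular[OF gr Vn reg tri] by blast
  have "cliques {v. v < n \<and> part' v = 0} E' 3 = {}" if adm': "admissible n \<beta> E' part'" for E' part'
  proof -
    let ?V' = "{v. v < n \<and> part' v = 0}"
    have "real (card ?V') = (1 - real (?p - 1) * \<beta>) * real n"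
      using adm' unfolding admissible_def Let_def by blast
    then have "real (card ?V') = real (card ?V)" using cV by (simp only:)
    then have c: "card ?V' = card ?V" by (simp only: of_nat_eq_iff)
    have all: "\<forall>H. graph (card ?V') H \<and> regular_on {..<card ?V'} H ((1 - real ?p * \<beta>) * real n)
        \<longrightarrow> card (cliques ?V' E' 3) \<le> kr (card ?V') H 3"
      using adm' unfolding admissible_def Let_def by blast
    have "card (cliques ?V' E' 3) \<le> 0"
      using all[unfolded c, rule_format, OF conjI[OF H(1,2)]] unfolding H(3) .
    moreover have "finite (cliques ?V' E' 3)" by (rule finite_cliques) simp
    ultimately show ?thesis by simp
  qed
  then show ?thesis unfolding feasible_def using fd by blast
qed

text \<open>The first \<open>m\<close> vertices carry a \<open>d\<close>-regular graph with fewest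
  triangles, and the rest is cut into \<open>p - 1\<close> consecutive intervals of length
  \<open>b\<close>.\<close>

lemma family_nonempty:
  assumes fd: "family_defined n \<beta>" and p: "p_of \<beta> = p" "1 \<le> p" and pb: "real p * \<beta> < 1"
  shows "\<exists>E part. graph n E \<and> admissible n \<beta> E part"
proof -
  obtain \<delta> where n: "0 < n" and \<beta>: "0 < \<beta>" "\<beta> < 1" and \<delta>: "0 < \<delta>" "real \<delta> = (1 - \<beta>) * real n"
    and par: "\<not> (odd n \<and> odd \<delta>)"
    using fd unfolding family_defined_def by blast
  define b where "b = n - \<delta>"
  have "real \<delta> \<le> real n" using \<beta> \<delta>(2) n mult_right_mono[of "1 - \<beta>" 1 "real n"] by simp
  then have dn: "\<delta> \<le> n" by simp
  have b: "real b = \<beta> * real n" using dn \<delta>(2) by (simp add: b_def of_nat_diff algebra_simps)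
  have b0: "0 < b" using b \<beta> n by (metis mult_pos_pos of_nat_0_less_iff)
  have "real (p * b) < real n"
    using mult_strict_right_mono[OF pb, of "real n"] n b by (simp add: mult.assoc)
  then have pbn: "p * b < n" by linarith
  have pb_split: "p * b = (p - 1) * b + b" using p by (cases p) auto
  define m where "m = n - (p - 1) * b"
  define d where "d = n - p * b"
  have nm: "n = m + (p - 1) * b" using pbn pb_split by (simp add: m_def)
  have md: "m = d + b" using pbn pb_split by (simp add: m_def d_def)
  have nd: "n = d + p * b" using pbn by (simp add: d_def)
  \<comment> \<open>For odd \<open>b\<close>, \<open>m = d + b\<close> gives \<open>m\<close> and
    \<open>d\<close> different parity. For even \<open>b\<close>, the numbers \<open>n\<close>,
    \<open>\<delta>\<close> and \<open>d\<close> have the same parity and hence are all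
    even.\<close>
  have ev: "even (m * d)"
  proof (cases "even b")
    case True
    have "n = \<delta> + b" using dn by (simp add: b_def)
    then have "even n \<longleftrightarrow> even \<delta>" using True by (metis even_add)
    moreover have "even (p * b)" using True by simp
    then have "even n \<longleftrightarrow> even d" using nd by (metis even_add)
    ultimately show ?thesis using par by auto
  qed (use md in auto)
  have dr: "real d = (1 - real p * \<beta>) * real n"
    using pbn b by (simp add: d_def of_nat_diff algebra_simps)
  have mr: "real m = (1 - real (p - 1) * \<beta>) * real n"
  proof -
    have "real n = real m + real (p - 1) * real b" using nm by (metis of_nat_add of_nat_mult)
    then show ?thesis using b by (simp add: algebra_simps)
  qed
  let ?P = "\<lambda>H. graph m H \<and> regular_on {..<m} H (real d)"
  obtain H0 where H0: "graph m H0" "\<forall>v<m. degree {..<m} H0 v = d"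
    using exists_regular_graph[of d m] ev md b0 by auto
  then have "?P H0" by (simp add: regular_on_def)
  then obtain H where H: "?P H" "\<forall>H'. ?P H' \<longrightarrow> kr m H 3 \<le> kr m H' 3"
    using ex_has_least_nat[of ?P H0 "\<lambda>H. kr m H 3"] by blast
  have Hm: "H u v \<Longrightarrow> u < m \<and> v < m" for u v using H(1) by (auto simp: graph_def)
  define part where "part = (\<lambda>v. if v < m then 0 else Suc ((v - m) div b))"
  define E where "E = (\<lambda>u v. u < n \<and> v < n \<and> (part u \<noteq> part v \<or> H u v))"
  have part0: "part v = 0 \<longleftrightarrow> v < m" for v by (simp add: part_def)
  have mn: "m \<le> n" by (simp add: m_def)
  have V0: "{v. v < n \<and> part v = 0} = {..<m}" using mn by (auto simp: part0)
  have EH: "E u v \<longleftrightarrow> H u v" if "u < m" "v < m" for u v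
    using that mn by (auto simp: E_def part_def)
  have cl: "cliques {..<m} E 3 = cliques {..<m} H 3"
    using EH by (auto simp: cliques_def subset_iff)
  have Vi: "{v. v < n \<and> part v = i} = {m + (i - 1) * b..<m + i * b}" if i: "1 \<le> i" "i \<le> p - 1" for i
  proof -
    obtain j where j: "i = Suc j" using i by (metis One_nat_def Suc_le_D)
    have le: "m + i * b \<le> n" unfolding nm using i by simp
    have dv: "(v - m) div b = j \<longleftrightarrow> j * b \<le> v - m \<and> v - m < Suc j * b" for v
      using b0 by (metis div_nat_eqI dividend_less_div_times div_times_less_eq_dividend mult.commute mult_Suc_right add.commute)
    show ?thesis
    proof (intro equalityI subsetI)
      fix v assume "v \<in> {v. v < n \<and> part v = i}"
      then show "v \<in> {m + (i - 1) * b..<m + i * b}" using j dv by (auto simp: part_def split: if_splits)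
    next
      fix v assume v: "v \<in> {m + (i - 1) * b..<m + i * b}"
      then have "\<not> v < m" "j * b \<le> v - m" "v - m < Suc j * b" using j by auto
      then have "part v = i" using dv j by (simp add: part_def)
      then show "v \<in> {v. v < n \<and> part v = i}" using v le by auto
    qed
  qed
  have gr: "graph n E"
    using H(1) by (auto simp: graph_def E_def)
  have plt: "part v < p" if "v < n" for v
  proof (cases "v < m")
    case False
    then have "v - m < (p - 1) * b" using that nm by linarith
    then have "(v - m) div b < p - 1" by (rule less_mult_imp_div_less)
    then show ?thesis using False by (simp add: part_def)
  qed (use p in \<open>simp add: part_def\<close>)
  have "admissible n \<beta> E part"
    unfolding admissible_def Let_def p(1)
  proof (intro conjI allI impI ballI)
    show "real (card {v. v < n \<and> part v = 0}) = (1 - real (p - 1) * \<beta>) * real n"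
      unfolding V0 using mr by simp
    show "regular_on {v. v < n \<and> part v = 0} E ((1 - real p * \<beta>) * real n)"
      unfolding V0 regular_on_def dr[symmetric]
    proof
      fix v assume v: "v \<in> {..<m}"
      then have "degree {..<m} E v = degree {..<m} H v"
        unfolding degree_def using EH by (intro arg_cong[of _ _ card]) auto
      then show "real (degree {..<m} E v) = real d" using H(1) v by (simp add: regular_on_def)
    qed
    show "card (cliques {v. v < n \<and> part v = 0} E 3) \<le> kr (card {v. v < n \<and> part v = 0}) H' 3"
      if "graph (card {v. v < n \<and> part v = 0}) H'
        \<and> regular_on {..<card {v. v < n \<and> part v = 0}} H' ((1 - real p * \<beta>) * real n)" for H'
      using that H(2) unfolding V0 cl dr[symmetric] by (simp add: kr_def)
    fix i assume i: "1 \<le> i \<and> i \<le> p - 1"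
    show "real (card {v. v < n \<and> part v = i}) = \<beta> * real n"
    proof -
      obtain j where "i = Suc j" using i by (metis One_nat_def Suc_le_D)
      then have "card {v. v < n \<and> part v = i} = b" using Vi[of i] i by simp
      then show ?thesis using b by simp
    qed
    show "\<not> E u v" if "u \<in> {v. v < n \<and> part v = i}" "v \<in> {v. v < n \<and> part v = i}" for u v
    proof -
      have "part u = part v" "\<not> u < m" using that i part0[of u] by auto
      then show ?thesis using Hm by (auto simp: E_def)
    qed
  qed (use plt in \<open>auto simp: E_def\<close>)
  then show ?thesis using gr by blast
qed

text \<open>\<open>\<gamma>\<close> is \<open>p + 1\<close> times the distance from
  \<open>1 / (p + 1)\<close> to \<open>\<beta>\<close>, so the bounds on \<open>\<gamma>\<close> in
  \<open>small1\<close> and \<open>small2\<close> are divided by \<open>p + 1\<close>.\<close>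

definition threshold :: "nat \<Rightarrow> real" where
  "threshold p = min (1 / (2 * (real p + 1) * 3 ^ p))
     ((1 / (4 * (real p + 1) ^ 2)) ^ (p + 2) / (Z_const p * (real p + 1) ^ (2 * p))) / (real p + 1)"

lemma Z_const_pos: "0 < Z_const p"
  unfolding Z_const_def by (intro mult_pos_pos zero_less_power) auto

lemma threshold_pos: "0 < threshold p"
proof -
  have "0 < (1 / (4 * (real p + 1) ^ 2)) ^ (p + 2)" by (intro zero_less_power divide_pos_pos) auto
  moreover have "0 < Z_const p * (real p + 1) ^ (2 * p)"
    using Z_const_pos by (intro mult_pos_pos) auto
  ultimately show ?thesis by (simp add: threshold_def)
qed

lemma near_turanI:
  assumes "min_degree_graph n E \<beta>" "2 \<le> p" "1 / (real p + 1) \<le> \<beta>" "\<beta> < 1 / (real p + 1) + threshold p"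
  shows "near_turan n E \<beta> p"
proof -
  let ?W = "2 * (real p + 1) * 3 ^ p"
  let ?W' = "Z_const p * (real p + 1) ^ (2 * p)"
  let ?k = "(1 / (4 * (real p + 1) ^ 2)) ^ (p + 2)"
  have W: "0 < ?W" "0 < ?W'" using Z_const_pos[of p] by (auto intro!: mult_pos_pos)
  have "(real p + 1) * \<beta> - 1 \<le> (real p + 1) * threshold p"
    using mult_left_mono[OF less_imp_le[OF assms(4)], of "real p + 1"] by (simp add: distrib_left)
  also have "\<dots> = min (1 / ?W) (?k / ?W')" by (simp add: threshold_def)
  finally have "(real p + 1) * \<beta> - 1 \<le> 1 / ?W" "(real p + 1) * \<beta> - 1 \<le> ?k / ?W'" by simp_all
  then have "((real p + 1) * \<beta> - 1) * ?W \<le> 1" "((real p + 1) * \<beta> - 1) * ?W' \<le> ?k"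
    unfolding pos_le_divide_eq[OF W(1)] pos_le_divide_eq[OF W(2)] .
  then show ?thesis
    using assms(1-3) by (intro near_turan.intro near_turan_axioms.intro) (simp_all only: mult.assoc)
qed

section \<open>Combining the lower bound with the equality case\<close>

lemma clique_minimum:
  assumes p: "1 \<le> p" and n: "0 < n" and \<delta>: "0 < \<delta>"
    and low: "(1 - 1 / real (p + 1) - (if p = 1 then 1 / 2 else threshold p)) * real n < real \<delta>"
    and high: "real \<delta> \<le> (1 - 1 / real (p + 1)) * real n" and \<beta>_def: "\<beta> = 1 - real \<delta> / real n"
  shows "\<And>r. 1 \<le> r \<Longrightarrow> g r \<beta> * real n ^ r \<le> real (kmin n \<delta> r)"
    and "\<And>r. 3 \<le> r \<Longrightarrow> r \<le> p + 1 \<Longrightarrow> real (kmin n \<delta> r) = g r \<beta> * real n ^ r \<longleftrightarrow> feasible n \<beta>"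
    and "\<And>r E. 3 \<le> r \<Longrightarrow> r \<le> p + 1 \<Longrightarrow> feasible n \<beta> \<Longrightarrow> graph n E \<Longrightarrow> mindeg n E = \<delta> \<Longrightarrow>
      real (kr n E r) = g r \<beta> * real n ^ r \<longleftrightarrow> E \<in> family n \<beta>"
proof -
  have \<delta>n: "real \<delta> = (1 - \<beta>) * real n" using n by (simp add: \<beta>_def)
  have \<beta>_ge: "1 / (real p + 1) \<le> \<beta>"
    using high n unfolding \<delta>n by (simp add: add.commute)
  have \<beta>_lt: "\<beta> < 1 / (real p + 1) + (if p = 1 then 1 / 2 else threshold p)"
  proof -
    have "1 - 1 / real (p + 1) - (if p = 1 then 1 / 2 else threshold p) < 1 - \<beta>"
      using low n unfolding \<delta>n by (simp only: mult_less_cancel_right_pos of_nat_0_less_iff)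
    then show ?thesis by (simp add: add.commute)
  qed
  have "0 < 1 / (real p + 1)" by simp
  then have \<beta>0: "0 < \<beta>" using \<beta>_ge by linarith
  have \<beta>1: "\<beta> < 1" using \<delta> n by (simp add: \<beta>_def)
  have "real \<delta> < real n" using \<delta>n \<beta>0 n by simp
  then have \<delta>lt: "\<delta> < n" by simp
  have mdg: "min_degree_graph n E \<beta>" if "graph n E" "mindeg n E = \<delta>" for E
    by (rule min_degree_graphI[OF that n \<delta>n[symmetric]])
  have nt: "near_turan n E \<beta> p" if "2 \<le> p" "graph n E" "mindeg n E = \<delta>" for E
    using near_turanI[OF mdg[OF that(2,3)] that(1) \<beta>_ge] \<beta>_lt that(1) by simp
  have pb: "real p * \<beta> < 1"
  proof (cases "p = 1")
    case False
    \<comment> \<open>The claim concerns numbers only, but \<open>density_pos\<close> belongs to a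
      locale about a graph; any graph with this minimum degree provides an instance.\<close>
    obtain E where "graph n E" "mindeg n E = \<delta>" using exists_mindeg[OF \<delta>lt] by blast
    then show ?thesis using near_turan.density_pos[OF nt, of E p] False p by simp
  qed (use \<beta>1 in simp)
  have pof: "p_of \<beta> = p" by (rule p_of_eq[OF \<beta>_ge pb])
  have gg: "g r \<beta> = g_of p \<beta> r" if "1 \<le> r" for r by (rule g_eq_g_of[OF p pof that])
  have iff: "real (kr n E r) = g r \<beta> * real n ^ r \<longleftrightarrow> min_degree_graph.avg n E (\<lambda>_. 1) r = g_of p \<beta> r"
    if "graph n E" "mindeg n E = \<delta>" "1 \<le> r" for E r
    unfolding min_degree_graph.kappa_eq[OF mdg[OF that(1,2)]] gg[OF that(3)] using n by (simp add: field_simps)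
  have lower: "g r \<beta> * real n ^ r \<le> real (kr n E r)" if E: "graph n E" "mindeg n E = \<delta>" and r: "1 \<le> r" for E r
  proof -
    interpret min_degree_graph n E \<beta> by (rule mdg[OF E])
    have "g_of p \<beta> r \<le> \<kappa> r"
    proof (cases "p = 1")
      case True
      then show ?thesis using g_of_1_le_kappa[OF r] by simp
    next
      case False
      then interpret near_turan n E \<beta> p using nt E p by simp
      show ?thesis
      proof (cases "r \<le> Suc p")
        case True
        then show ?thesis using kappa_ge(1) r by blast
      next
        case False
        then show ?thesis using g_of_0[of p r] p avg_nonneg[of r "\<lambda>_. 1"] by simp
      qed
    qed
    then show ?thesis using n unfolding kappa_eq gg[OF r] by (simp add: field_simps)
  qed
  show "g r \<beta> * real n ^ r \<le> real (kmin n \<delta> r)" if "1 \<le> r" for r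
    using kmin_props(1)[OF \<delta>lt, of r] lower that by metis
  have member: "real (kr n E r) = g r \<beta> * real n ^ r"
    if E: "graph n E" "mindeg n E = \<delta>" "admissible n \<beta> E part" and f: "feasible n \<beta>"
      and r: "1 \<le> r" "r \<le> p + 1" for E part r
  proof -
    have tri: "cliques {v. v < n \<and> part v = 0} E 3 = {}"
      using f E unfolding feasible_def family_def by blast
    have "min_degree_graph.avg n E (\<lambda>_. 1) r = g_of p \<beta> r"
      by (rule min_degree_graph.kappa_member[OF mdg[OF E(1,2)] E(3) pof p \<beta>0 pb refl tri]) (use r in auto)
    then show ?thesis using iff[OF E(1,2) r(1)] by simp
  qed
  have tight: "\<exists>part. admissible n \<beta> E part \<and> cliques {v. v < n \<and> part v = 0} E 3 = {}"
    if E: "graph n E" "mindeg n E = \<delta>" and r: "3 \<le> r" "r \<le> p + 1" and eq: "real (kr n E r) = g r \<beta> * real n ^ r" for E r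
  proof (rule near_turan.tight_admissible)
    \<comment> \<open>From \<open>3 \<le> r\<close> and \<open>r \<le> p + 1\<close> it follows that
      \<open>p \<ge> 2\<close>.\<close>
    show "near_turan n E \<beta> p" using nt E r by simp
    show "real (n - \<delta>) = \<beta> * real n" using \<delta>lt \<delta>n by (simp add: of_nat_diff algebra_simps)
    show "min_degree_graph.avg n E (\<lambda>_. 1) r = g_of p \<beta> r" using iff[OF E, of r] r eq by simp
  qed (use r in auto)
  have mindeg_member: "mindeg n E = \<delta>" if "graph n E" "admissible n \<beta> E part" for E part
  proof (rule mindeg_regular[OF n])
    fix v assume "v < n"
    then have "real (degree {..<n} E v) = real \<delta>" using family_degree[OF that pof] \<delta>n by simp
    then show "degree {..<n} E v = \<delta>" by (simp only: of_nat_eq_iff)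
  qed
  show "real (kmin n \<delta> r) = g r \<beta> * real n ^ r \<longleftrightarrow> feasible n \<beta>" if r: "3 \<le> r" "r \<le> p + 1" for r
  proof
    assume eq: "real (kmin n \<delta> r) = g r \<beta> * real n ^ r"
    obtain E where E: "graph n E" "mindeg n E = \<delta>" "kr n E r = kmin n \<delta> r"
      using kmin_props(1)[OF \<delta>lt] by blast
    then obtain part where "admissible n \<beta> E part" "cliques {v. v < n \<and> part v = 0} E 3 = {}"
      using tight[OF E(1,2) r] eq by auto
    then show "feasible n \<beta>" using feasibleI[OF E(1)] n \<beta>0 \<beta>1 \<delta> \<delta>n by blast
  next
    assume f: "feasible n \<beta>"
    then have "family_defined n \<beta>" by (simp add: feasible_def)
    then obtain E part where E: "graph n E" "admissible n \<beta> E part"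
      using family_nonempty[OF _ pof p pb] by blast
    note m = mindeg_member[OF E]
    have "real (kr n E r) = g r \<beta> * real n ^ r" using member[OF E(1) m E(2) f] r by simp
    moreover have "kmin n \<delta> r \<le> kr n E r" by (rule kmin_props(2)[OF \<delta>lt E(1) m])
    moreover have "g r \<beta> * real n ^ r \<le> real (kmin n \<delta> r)"
      using kmin_props(1)[OF \<delta>lt, of r] lower r by (metis one_le_numeral order_trans)
    ultimately show "real (kmin n \<delta> r) = g r \<beta> * real n ^ r" by linarith
  qed
  show "real (kr n E r) = g r \<beta> * real n ^ r \<longleftrightarrow> E \<in> family n \<beta>"
    if r: "3 \<le> r" "r \<le> p + 1" and f: "feasible n \<beta>" and E: "graph n E" "mindeg n E = \<delta>" for r E
  proof
    assume "real (kr n E r) = g r \<beta> * real n ^ r"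
    then show "E \<in> family n \<beta>" using tight[OF E r] E(1) by (auto simp: family_def)
  next
    assume "E \<in> family n \<beta>"
    then show "real (kr n E r) = g r \<beta> * real n ^ r"
      using member[OF E _ f] r by (auto simp: family_def)
  qed
qed

theorem mainTheorem4:
  fixes p :: nat
  assumes "1 \<le> p"
  shows "\<exists>\<epsilon>::real. \<epsilon> > 0 \<and>
    (\<forall>n \<delta> :: nat. 0 < n \<longrightarrow> 0 < \<delta> \<longrightarrow>
       (1 - 1 / real (p + 1) - \<epsilon>) * real n < real \<delta> \<longrightarrow>
       real \<delta> \<le> (1 - 1 / real (p + 1)) * real n \<longrightarrow>
       (let \<beta> = 1 - real \<delta> / real n in
         (\<forall>r::nat. 1 \<le> r \<longrightarrow> real (kmin n \<delta> r) \<ge> g r \<beta> * real n ^ r) \<and>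
         (\<forall>r::nat. 3 \<le> r \<and> r \<le> p + 1 \<longrightarrow>
            (real (kmin n \<delta> r) = g r \<beta> * real n ^ r \<longleftrightarrow> feasible n \<beta>) \<and>
            (feasible n \<beta> \<longrightarrow>
               (\<forall>E. graph n E \<and> mindeg n E = \<delta> \<longrightarrow>
                  (real (kr n E r) = g r \<beta> * real n ^ r \<longleftrightarrow> E \<in> family n \<beta>))))))"
proof (intro exI[of _ "if p = 1 then 1 / 2 else threshold p"] conjI allI impI)
  show "0 < (if p = 1 then 1 / 2 else threshold p)" using threshold_pos by simp
  fix n \<delta> :: nat
  assume "0 < n" "0 < \<delta>"
    "(1 - 1 / real (p + 1) - (if p = 1 then 1 / 2 else threshold p)) * real n < real \<delta>"
    "real \<delta> \<le> (1 - 1 / real (p + 1)) * real n"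
  note * = clique_minimum[OF assms this refl]
  show "let \<beta> = 1 - real \<delta> / real n in
         (\<forall>r::nat. 1 \<le> r \<longrightarrow> real (kmin n \<delta> r) \<ge> g r \<beta> * real n ^ r) \<and>
         (\<forall>r::nat. 3 \<le> r \<and> r \<le> p + 1 \<longrightarrow>
            (real (kmin n \<delta> r) = g r \<beta> * real n ^ r \<longleftrightarrow> feasible n \<beta>) \<and>
            (feasible n \<beta> \<longrightarrow>
               (\<forall>E. graph n E \<and> mindeg n E = \<delta> \<longrightarrow>
                  (real (kr n E r) = g r \<beta> * real n ^ r \<longleftrightarrow> E \<in> family n \<beta>))))"
    unfolding Let_def using * by blast
qed

end
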